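(* Suppose there is a nonrandom constant $M>1$ such that $\lim_{n\to\infty}\mathbb P(\tau_n<M|\ell_n|)=1$. Then the restriction of the shape function $\Lambda$ to $[0,1/M]$ is linear.
   Context: Let $c>0$, $q>0$, $\kappa>-1$. $F=(F(x))_{x\in\mathbb Z}$ and $B=(B(i))_{i\in\mathbb Z}$ are mutually independent families of i.i.d. random variables, $\mathbb P(B(i)=\pm1)=1/2$, and $F(x)$ has a density $\varrho$ that is even, continuous, strictly positive on $(-c,c)$, zero outside $(-c,c)$, with $\lim_{x\to c}\varrho(x)/|c-x|^{\kappa}=q$. A lazy walk satisfies $|\gamma(i+1)-\gamma(i)|\le1$; the action of a lazy walk $\gamma$ on $\{0,\dots,n\}$ is $A(B,F;\gamma)=\sum_{i=1}^nB(i)F(\gamma(i))$; $\bar A(B,F;n,k)$ is the minimal action over lazy walks from $(0,0)$ to $(n,k)$; the shape function $\Lambda:[-1,1]\to[0,\infty)$ is the deterministic function with $\bar A(B,F;n,[\alpha n])/n\to-\Lambda(\alpha)$ almost surely ($[\cdot]$ rounding towards $0$). $\bar\gamma_n$ denotes a minimizer of $A(B,F;\cdot)$ among lazy walks of length $n$ with $\gamma(0)=0$ (free endpoint). With $d(x)=2c-|F(x+1)-F(x)|$, $\ell_n=\operatorname{argmin}_{x\in\operatorname{range}(\bar\gamma_n)}d(x)$ and $\tau_n=\min\{i:\bar\gamma_n(i)\in\{\ell_n,\ell_n+1\}\}$. *)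

theory Defs
  imports "HOL-Probability.Probability"
begin

definition round0 :: "real \<Rightarrow> int" where
  "round0 x = (if x \<ge> 0 then \<lfloor>x\<rfloor> else \<lceil>x\<rceil>)"

text \<open>Lazy walk on time interval 0..n started at 0 (values after time n are irrelevant).\<close>
definition lazy_walk :: "nat \<Rightarrow> (nat \<Rightarrow> int) \<Rightarrow> bool" where
  "lazy_walk n \<gamma> \<longleftrightarrow> \<gamma> 0 = 0 \<and> (\<forall>i<n. \<bar>\<gamma> (Suc i) - \<gamma> i\<bar> \<le> 1)"

definition action :: "(int \<Rightarrow> real) \<Rightarrow> (int \<Rightarrow> real) \<Rightarrow> nat \<Rightarrow> (nat \<Rightarrow> int) \<Rightarrow> real" where
  "action B F n \<gamma> = (\<Sum>i=1..n. B (int i) * F (\<gamma> i))"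

definition min_action :: "(int \<Rightarrow> real) \<Rightarrow> (int \<Rightarrow> real) \<Rightarrow> nat \<Rightarrow> int \<Rightarrow> real" where
  "min_action B F n k = Min {action B F n \<gamma> | \<gamma>. lazy_walk n \<gamma> \<and> \<gamma> n = k}"

definition free_minimizer :: "(int \<Rightarrow> real) \<Rightarrow> (int \<Rightarrow> real) \<Rightarrow> nat \<Rightarrow> (nat \<Rightarrow> int) \<Rightarrow> bool" where
  "free_minimizer B F n \<gamma> \<longleftrightarrow> lazy_walk n \<gamma> \<and>
     (\<forall>\<gamma>'. lazy_walk n \<gamma>' \<longrightarrow> action B F n \<gamma> \<le> action B F n \<gamma>')"

definition dgap :: "real \<Rightarrow> (int \<Rightarrow> real) \<Rightarrow> int \<Rightarrow> real" where
  "dgap c F x = 2 * c - \<bar>F (x + 1) - F x\<bar>"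

definition is_ell :: "real \<Rightarrow> (int \<Rightarrow> real) \<Rightarrow> nat \<Rightarrow> (nat \<Rightarrow> int) \<Rightarrow> int \<Rightarrow> bool" where
  "is_ell c F n \<gamma> l \<longleftrightarrow> l \<in> \<gamma> ` {0..n} \<and> (\<forall>x\<in>\<gamma> ` {0..n}. dgap c F l \<le> dgap c F x)"

definition tau :: "(nat \<Rightarrow> int) \<Rightarrow> int \<Rightarrow> nat" where
  "tau \<gamma> l = (LEAST i. \<gamma> i \<in> {l, l + 1})"

end

theory Submission
  imports Defs
begin

text \<open>
  Put \<open>G = c - \<Lambda>\<close>, the excess of the action per unit of time over the ideal value \<open>- c\<close>. One can stay near the
  origin at no cost to leading order, so \<open>G 0 = 0\<close> and \<open>G \<alpha> / \<alpha>\<close>, the cost of travelling a unit of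
  distance at speed \<open>\<alpha>\<close>, is nondecreasing; let \<open>g\<close> be its limit at \<open>0\<close>. If \<open>\<Lambda>\<close> is not linear on
  \<open>[0, 1/K]\<close>, then travelling at speed at least \<open>1/K\<close> costs at least \<open>g + \<delta>\<close> per unit of distance.

  Balancing the cost of travelling to an edge with small gap against the cost of staying there until time \<open>n\<close> gives a
  scale \<open>L = o(n)\<close> such that, with probability close to one, the minimizer stays within distance \<open>C L\<close> of
  the origin while \<open>\<bar>\<ell>\<^sub>n\<bar> > a L\<close>. Under the hypothesis its first leg, up to time \<open>\<tau>\<^sub>n\<close>, is fast and costs
  \<open>(g + \<delta>) \<bar>\<ell>\<^sub>n\<bar>\<close>, and the rest up to time \<open>T = \<theta> L\<close> costs at least \<open>g\<close> times the distance gained.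
  For large \<open>\<theta>\<close> the endpoint at time \<open>T\<close> can be reached slowly, at \<open>g\<close> per unit of distance, which is cheaper
  by an amount of order \<open>\<delta> a L\<close>: a contradiction.
\<close>

subsection \<open>Paths in a fixed environment\<close>

text \<open>The obstacle is that the shape function speaks only about walks from the space-time
  origin, and only almost surely as the horizon grows, while the argument restarts the environment
  at a time that varies with \<open>n\<close>. Such a restart keeps the law but not the almost sure
  statements. Hence every ingredient is turned into an event at a single large \<open>n\<close>,
  with a lower bound on its probability, and one sample in the intersection gives the contradiction.
  The minimizer is confined by two elementary bounds: each new site \<open>x\<close> costs at least
  \<open>c - \<bar>F x\<bar>\<close>, so escaping costs linearly in the distance, and each sign
  change of \<open>B\<close> costs at least the smallest gap met, so staying costs that gap times
  the order of \<open>n\<close>. The edge behaviour of the density enters as a doubling property of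
  its tail, which makes gaps of order \<open>L / n\<close> comparable up to constants. It shows that
  an edge with so small a gap is unlikely very close to the origin.\<close>

definition excess :: "real \<Rightarrow> (int \<Rightarrow> real) \<Rightarrow> (int \<Rightarrow> real) \<Rightarrow> nat \<Rightarrow> int \<Rightarrow> real" where
  "excess c b f t x = c * real t + min_action b f t x"

text \<open>The time interval is half-open, so that costs of consecutive legs add up and time 0 is
  not charged, as in \<open>action\<close>.\<close>

definition cost :: "real \<Rightarrow> (int \<Rightarrow> real) \<Rightarrow> (int \<Rightarrow> real) \<Rightarrow> (nat \<Rightarrow> int) \<Rightarrow> nat \<Rightarrow> nat \<Rightarrow> real" where
  "cost c b f \<gamma> s t = (\<Sum>i\<in>{s<..t}. c + b (int i) * f (\<gamma> i))"

text \<open>The almost sure properties of a sample that the path estimates use; with them these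
  estimates become deterministic.\<close>

definition admissible_env :: "real \<Rightarrow> (int \<Rightarrow> real) \<Rightarrow> (int \<Rightarrow> real) \<Rightarrow> bool" where
  "admissible_env c b f \<longleftrightarrow> (\<forall>i. b i = 1 \<or> b i = -1) \<and> (\<forall>x. \<bar>f x\<bar> \<le> c)"

lemma cost_0_eq_action: "cost c b f \<gamma> 0 n = c * real n + action b f n \<gamma>"
proof -
  have "{0<..n} = {1..n}" by auto
  then show ?thesis by (simp add: cost_def action_def sum.distrib)
qed

lemma cost_split: "s \<le> t \<Longrightarrow> t \<le> u \<Longrightarrow> cost c b f \<gamma> s u = cost c b f \<gamma> s t + cost c b f \<gamma> t u"
  unfolding cost_def
  by (subst sum.union_disjoint[symmetric]) (auto simp: ivl_disj_un)

lemma cost_cong: "(\<And>i. s < i \<Longrightarrow> i \<le> t \<Longrightarrow> \<gamma> i = \<gamma>' i) \<Longrightarrow> cost c b f \<gamma> s t = cost c b f \<gamma>' s t"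
  unfolding cost_def by (intro sum.cong) auto

lemma admissible_env_site_nonneg:
  assumes "admissible_env c b f" shows "0 \<le> c - \<bar>f x\<bar>"
  using assms by (simp add: admissible_env_def)

lemma admissible_env_step_bounds:
  assumes "admissible_env c b f"
  shows "c - \<bar>f x\<bar> \<le> c + b i * f x" "c + b i * f x \<le> 2 * c" "0 \<le> c + b i * f x"
proof -
  have b: "b i = 1 \<or> b i = -1" and f: "\<bar>f x\<bar> \<le> c"
    using assms by (auto simp: admissible_env_def)
  show "c - \<bar>f x\<bar> \<le> c + b i * f x" "c + b i * f x \<le> 2 * c" "0 \<le> c + b i * f x"
    using b f by auto
qed

lemma cost_nonneg: "admissible_env c b f \<Longrightarrow> 0 \<le> cost c b f \<gamma> s t"
  unfolding cost_def by (intro sum_nonneg admissible_env_step_bounds)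

lemma cost_le: 
  assumes "admissible_env c b f" "s \<le> t"
  shows "cost c b f \<gamma> s t \<le> 2 * c * real (t - s)"
  using sum_bounded_above[of "{s<..t}" "\<lambda>i. c + b (int i) * f (\<gamma> i)" "2 * c"]
    admissible_env_step_bounds(2)[OF assms(1)] by (simp add: cost_def mult.commute)

lemma lazy_walk_dist:
  assumes "\<forall>i\<in>{s..<t}. \<bar>\<gamma> (Suc i) - \<gamma> i\<bar> \<le> (1::int)" "s \<le> t"
  shows "\<bar>\<gamma> t - \<gamma> s\<bar> \<le> int (t - s)"
  using assms(2,1)
proof (induction t rule: dec_induct)
  case (step m)
  then have "\<bar>\<gamma> m - \<gamma> s\<bar> \<le> int (m - s)" "\<bar>\<gamma> (Suc m) - \<gamma> m\<bar> \<le> 1"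
    by auto
  then have "\<bar>\<gamma> (Suc m) - \<gamma> s\<bar> \<le> int (m - s) + 1" by linarith
  then show ?case using step by (simp add: Suc_diff_le)
qed simp

lemma lazy_walk_le:
  assumes "lazy_walk n \<gamma>" "i \<le> n" shows "\<bar>\<gamma> i\<bar> \<le> int i"
  using lazy_walk_dist[of 0 i \<gamma>] assms by (simp add: lazy_walk_def)

text \<open>A walk is arbitrary after time \<open>n\<close>, so there are infinitely many with the
  same action. The extensional representatives form a finite set, which makes the minimum attained
  and later measurable.\<close>

definition walks :: "nat \<Rightarrow> int \<Rightarrow> (nat \<Rightarrow> int) set" where
  "walks n k = {\<gamma> \<in> {0..n} \<rightarrow>\<^sub>E {- int n..int n}. lazy_walk n \<gamma> \<and> \<gamma> n = k}"

lemma finite_walks: "finite (walks n k)"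
  unfolding walks_def by (rule finite_subset[OF _ finite_PiE[of "{0..n}" "\<lambda>_. {- int n..int n}"]]) auto

lemma min_action_eq_Min_walks: "min_action b f n k = Min ((\<lambda>\<gamma>. action b f n \<gamma>) ` walks n k)"
proof -
  have "{action b f n \<gamma> | \<gamma>. lazy_walk n \<gamma> \<and> \<gamma> n = k} = (\<lambda>\<gamma>. action b f n \<gamma>) ` walks n k"
  proof (intro set_eqI iffI)
    fix a assume "a \<in> {action b f n \<gamma> | \<gamma>. lazy_walk n \<gamma> \<and> \<gamma> n = k}"
    then obtain \<gamma> where \<gamma>: "a = action b f n \<gamma>" "lazy_walk n \<gamma>" "\<gamma> n = k" by auto
    define \<delta> where "\<delta> = restrict \<gamma> {0..n}"
    have "lazy_walk n \<delta>" using \<gamma>(2) by (auto simp: lazy_walk_def \<delta>_def)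
    moreover have "\<bar>\<gamma> i\<bar> \<le> int n" if "i \<le> n" for i
      using lazy_walk_le[OF \<gamma>(2) that] that by linarith
    then have "\<delta> \<in> {0..n} \<rightarrow>\<^sub>E {- int n..int n}"
      unfolding \<delta>_def restrict_PiE_iff by (force simp: abs_le_iff)
    moreover have "action b f n \<delta> = a"
      unfolding \<gamma> action_def by (intro sum.cong) (auto simp: \<delta>_def)
    ultimately show "a \<in> (\<lambda>\<gamma>. action b f n \<gamma>) ` walks n k"
      using \<gamma>(3) by (auto simp: walks_def \<delta>_def intro!: image_eqI[of _ _ \<delta>])
  qed (auto simp: walks_def)
  then show ?thesis by (simp add: min_action_def)
qed

lemma excess_le_cost:
  assumes "lazy_walk n \<gamma>"
  shows "excess c b f n (\<gamma> n) \<le> cost c b f \<gamma> 0 n"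
proof -
  define \<delta> where "\<delta> = restrict \<gamma> {0..n}"
  have "\<bar>\<gamma> i\<bar> \<le> int n" if "i \<le> n" for i
    using lazy_walk_le[OF assms that] that by linarith
  then have "\<delta> \<in> {0..n} \<rightarrow>\<^sub>E {- int n..int n}"
    unfolding \<delta>_def restrict_PiE_iff by (force simp: abs_le_iff)
  then have "\<delta> \<in> walks n (\<gamma> n)"
    using assms by (auto simp: walks_def \<delta>_def lazy_walk_def)
  then have "min_action b f n (\<gamma> n) \<le> action b f n \<delta>"
    unfolding min_action_eq_Min_walks by (intro Min_le) (auto simp: finite_walks)
  also have "action b f n \<delta> = action b f n \<gamma>"
    unfolding action_def by (intro sum.cong) (auto simp: \<delta>_def)
  finally show ?thesis by (simp add: cost_0_eq_action excess_def)
qed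

lemma walks_nonempty:
  assumes "\<bar>k\<bar> \<le> int n" shows "walks n k \<noteq> {}"
proof -
  define \<gamma> where "\<gamma> = restrict (\<lambda>i. sgn k * min (int i) \<bar>k\<bar>) {0..n}"
  have "\<gamma> \<in> walks n k"
    using assms unfolding walks_def lazy_walk_def \<gamma>_def
    by (auto simp: sgn_if abs_if min_def split: if_splits)
  then show ?thesis by auto
qed

lemma excess_attained:
  assumes "\<bar>k\<bar> \<le> int n"
  obtains \<gamma> where "lazy_walk n \<gamma>" "\<gamma> n = k" "excess c b f n k = cost c b f \<gamma> 0 n"
proof -
  have "Min ((\<lambda>\<gamma>. action b f n \<gamma>) ` walks n k) \<in> (\<lambda>\<gamma>. action b f n \<gamma>) ` walks n k"
    by (intro Min_in) (auto simp: finite_walks walks_nonempty[OF assms])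
  then obtain \<gamma> where "\<gamma> \<in> walks n k" "min_action b f n k = action b f n \<gamma>"
    unfolding min_action_eq_Min_walks by auto
  then show ?thesis by (intro that[of \<gamma>]) (auto simp: walks_def excess_def cost_0_eq_action)
qed

lemma excess_nonneg:
  assumes "admissible_env c b f" "\<bar>k\<bar> \<le> int n" shows "0 \<le> excess c b f n k"
  using excess_attained[OF assms(2)] cost_nonneg[OF assms(1)] by metis

text \<open>Subadditivity: an optimal walk to \<open>\<gamma> s\<close> is glued in front of
  \<open>\<gamma>\<close>. What \<open>\<gamma>\<close> does before time \<open>s\<close> is
  irrelevant, only \<open>\<gamma> s\<close> must be reachable by then.\<close>

lemma excess_concat:
  assumes st: "s \<le> t" and s: "\<bar>\<gamma> s\<bar> \<le> int s"
    and step: "\<And>i. s \<le> i \<Longrightarrow> i < t \<Longrightarrow> \<bar>\<gamma> (Suc i) - \<gamma> i\<bar> \<le> 1"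
  shows "excess c b f t (\<gamma> t) \<le> excess c b f s (\<gamma> s) + cost c b f \<gamma> s t"
proof -
  obtain \<beta> where \<beta>: "lazy_walk s \<beta>" "\<beta> s = \<gamma> s" "excess c b f s (\<gamma> s) = cost c b f \<beta> 0 s"
    using excess_attained[OF s] .
  define \<delta> where "\<delta> i = (if i \<le> s then \<beta> i else \<gamma> i)" for i
  have "\<bar>\<delta> (Suc i) - \<delta> i\<bar> \<le> 1" if "i < t" for i
  proof -
    consider "i < s" | "i = s" | "i > s" by linarith
    then show ?thesis
    proof cases
      case 1 then show ?thesis using \<beta>(1) by (simp add: \<delta>_def lazy_walk_def)
    next
      case 2 then show ?thesis using step[of s] that \<beta>(2) by (simp add: \<delta>_def)
    next
      case 3 then show ?thesis using step[of i] that by (simp add: \<delta>_def)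
    qed
  qed
  then have "lazy_walk t \<delta>"
    using \<beta>(1) by (auto simp: lazy_walk_def \<delta>_def)
  moreover have "\<delta> t = \<gamma> t"
    using st \<beta>(2) by (cases "t = s") (auto simp: \<delta>_def)
  ultimately have "excess c b f t (\<gamma> t) \<le> cost c b f \<delta> 0 t"
    using excess_le_cost by metis
  also have "\<dots> = cost c b f \<delta> 0 s + cost c b f \<delta> s t"
    using st by (intro cost_split) auto
  also have "cost c b f \<delta> 0 s = cost c b f \<beta> 0 s"
    by (rule cost_cong) (simp add: \<delta>_def)
  also have "cost c b f \<delta> s t = cost c b f \<gamma> s t"
    by (rule cost_cong) (simp add: \<delta>_def)
  finally show ?thesis using \<beta>(3) by simp
qed

text \<open>Move straight from \<open>x\<close> to \<open>y\<close> and wait there; no step costs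
  more than \<open>2 * c\<close>.\<close>

lemma excess_extend:
  assumes env: "admissible_env c b f" and st: "s \<le> t" and x: "\<bar>x\<bar> \<le> int s" and xy: "\<bar>y - x\<bar> \<le> int (t - s)"
  shows "excess c b f t y \<le> excess c b f s x + 2 * c * real (t - s)"
proof -
  define \<gamma> where "\<gamma> i = x + sgn (y - x) * min (int (i - s)) \<bar>y - x\<bar>" for i
  have [simp]: "\<gamma> s = x" by (simp add: \<gamma>_def)
  have [simp]: "\<gamma> t = y" using xy by (simp add: \<gamma>_def min_absorb2 sgn_mult_abs)
  have "\<bar>\<gamma> (Suc i) - \<gamma> i\<bar> \<le> 1" for i
  proof -
    have "\<gamma> (Suc i) - \<gamma> i = sgn (y - x) * (min (int (Suc i - s)) \<bar>y - x\<bar> - min (int (i - s)) \<bar>y - x\<bar>)"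
      by (simp add: \<gamma>_def right_diff_distrib)
    moreover have "\<bar>min (int (Suc i - s)) \<bar>y - x\<bar> - min (int (i - s)) \<bar>y - x\<bar>\<bar> \<le> 1"
      by (auto simp: min_def)
    moreover have "sgn (y - x) = 1 \<or> sgn (y - x) = 0 \<or> sgn (y - x) = -1"
      by (simp add: sgn_if)
    ultimately show ?thesis by (elim disjE) (simp_all add: abs_minus_commute)
  qed
  then have "excess c b f t (\<gamma> t) \<le> excess c b f s (\<gamma> s) + cost c b f \<gamma> s t"
    using st x by (intro excess_concat) auto
  then show ?thesis using cost_le[OF env st, of \<gamma>] by simp
qed

text \<open>The path is run in the environment started \<open>T\<close> time units before the origin.\<close>
lemma excess_shift_concat:
  assumes st: "s \<le> t" and s: "\<bar>\<gamma> s\<bar> \<le> int (T + s)"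
    and step: "\<And>i. s \<le> i \<Longrightarrow> i < t \<Longrightarrow> \<bar>\<gamma> (Suc i) - \<gamma> i\<bar> \<le> 1"
  shows "excess c (\<lambda>i. b (i - int T)) f (T + t) (\<gamma> t) \<le>
         excess c (\<lambda>i. b (i - int T)) f (T + s) (\<gamma> s) + cost c b f \<gamma> s t"
proof -
  define \<delta> where "\<delta> i = \<gamma> (i - T)" for i
  have "\<bar>\<delta> (Suc i) - \<delta> i\<bar> \<le> 1" if "T + s \<le> i" "i < T + t" for i
    using step[of "i - T"] that by (simp add: \<delta>_def Suc_diff_le)
  then have "excess c (\<lambda>i. b (i - int T)) f (T + t) (\<delta> (T + t)) \<le>
         excess c (\<lambda>i. b (i - int T)) f (T + s) (\<delta> (T + s)) + cost c (\<lambda>i. b (i - int T)) f \<delta> (T + s) (T + t)"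
    using st s by (intro excess_concat) (auto simp: \<delta>_def)
  also have "cost c (\<lambda>i. b (i - int T)) f \<delta> (T + s) (T + t) = cost c b f \<gamma> s t"
    unfolding cost_def
    by (rule sum.reindex_bij_witness[of _ "\<lambda>i. i + T" "\<lambda>i. i - T"])
       (auto simp: \<delta>_def of_nat_diff)
  finally show ?thesis by (simp add: \<delta>_def)
qed

text \<open>A walk that is back at the origin at time \<open>s\<close> sees the same sites again,
  but a shifted sequence of signs.\<close>

lemma excess_restart:
  assumes k: "\<bar>k\<bar> \<le> int m"
  shows "excess c b f (s + m) k \<le> excess c b f s 0 + excess c (\<lambda>i. b (i + int s)) f m k"
proof -
  obtain \<beta> where \<beta>: "lazy_walk m \<beta>" "\<beta> m = k" "excess c (\<lambda>i. b (i + int s)) f m k = cost c (\<lambda>i. b (i + int s)) f \<beta> 0 m"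
    using excess_attained[OF k] .
  define \<gamma> where "\<gamma> j = \<beta> (j - s)" for j
  have \<beta>0: "\<beta> 0 = 0" using \<beta>(1) by (simp add: lazy_walk_def)
  have "excess c b f (s + m) (\<gamma> (s + m)) \<le> excess c b f s (\<gamma> s) + cost c b f \<gamma> s (s + m)"
    using \<beta>(1) \<beta>0 by (intro excess_concat) (auto simp: \<gamma>_def lazy_walk_def Suc_diff_le)
  also have "cost c b f \<gamma> s (s + m) = cost c (\<lambda>i. b (i + int s)) f \<beta> 0 m"
    unfolding cost_def
    by (rule sum.reindex_bij_witness[of _ "\<lambda>i. i + s" "\<lambda>i. i - s"]) (auto simp: \<gamma>_def)
  finally show ?thesis using \<beta> \<beta>0 by (simp add: \<gamma>_def)
qed

lemma excess_reflect: "excess c b (\<lambda>x. f (- x)) n k = excess c b f n (- k)"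
proof -
  have "{action b (\<lambda>x. f (- x)) n \<gamma> | \<gamma>. lazy_walk n \<gamma> \<and> \<gamma> n = k} =
        {action b f n \<gamma> | \<gamma>. lazy_walk n \<gamma> \<and> \<gamma> n = - k}" (is "?A f k = ?B f k")
  proof -
    have *: "?A f k \<subseteq> ?B f k" for f k
    proof
      fix a assume "a \<in> ?A f k"
      then obtain \<gamma> where \<gamma>: "a = action b (\<lambda>x. f (- x)) n \<gamma>" "lazy_walk n \<gamma>" "\<gamma> n = k" by auto
      then have "a = action b f n (\<lambda>i. - \<gamma> i)" "lazy_walk n (\<lambda>i. - \<gamma> i)" "(- \<gamma> n) = - k"
        by (auto simp: action_def lazy_walk_def abs_if split: if_splits)
      then show "a \<in> ?B f k" by blast
    qed
    from *[of f k] *[of "\<lambda>x. f (- x)" "- k"] show ?thesis by auto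
  qed
  then show ?thesis by (simp add: excess_def min_action_def)
qed

lemma admissible_env_reflect: "admissible_env c b f \<Longrightarrow> admissible_env c b (\<lambda>x. f (- x))"
  by (auto simp: admissible_env_def)

section \<open>Lower bounds for the cost of a walk\<close>

text \<open>A lazy walk cannot jump over a site, so it visits all of \<open>1..m\<close>, and
  whatever the sign, a visit to \<open>x\<close> costs at least \<open>c - \<bar>f x\<bar>\<close>.
  One visit per site is counted.\<close>

lemma cost_ge_sites:
  assumes env: "admissible_env c b f" and \<gamma>: "lazy_walk n \<gamma>" and i: "i \<le> n" and m: "int m \<le> \<gamma> i"
  shows "(\<Sum>x=1..m. c - \<bar>f (int x)\<bar>) \<le> cost c b f \<gamma> 0 n"
proof -
  have vis: "int x \<in> \<gamma> ` {0<..n}" if x: "x \<in> {1..m}" for x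
  proof -
    have "\<exists>j\<le>i. \<gamma> j = int x"
      using \<gamma> i m x by (intro nat0_intermed_int_val) (auto simp: lazy_walk_def)
    then obtain j where j: "j \<le> i" "\<gamma> j = int x" by auto
    \<comment> \<open>The visit has to fall at a positive time, because the cost does not include
      time 0.\<close>
    then have "j \<noteq> 0" using \<gamma> x by (auto simp: lazy_walk_def intro!: Nat.gr0I)
    then show ?thesis using j i by (auto intro!: image_eqI[of _ _ j])
  qed
  have "(\<Sum>x=1..m. c - \<bar>f (int x)\<bar>) = (\<Sum>x\<in>int ` {1..m}. c - \<bar>f x\<bar>)"
    by (subst sum.reindex) auto
  also have "\<dots> \<le> (\<Sum>x\<in>\<gamma> ` {0<..n}. c - \<bar>f x\<bar>)"
    using vis admissible_env_site_nonneg[OF env] by (intro sum_mono2) auto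
  also have "\<dots> \<le> (\<Sum>i\<in>{0<..n}. ((\<lambda>x. c - \<bar>f x\<bar>) \<circ> \<gamma>) i)"
    by (rule sum_image_le) (use env in \<open>auto simp: admissible_env_def\<close>)
  also have "\<dots> \<le> cost c b f \<gamma> 0 n"
    unfolding cost_def comp_def by (intro sum_mono admissible_env_step_bounds(1)[OF env])
  finally show ?thesis .
qed

lemma cost_ge_sites_neg:
  assumes env: "admissible_env c b f" and \<gamma>: "lazy_walk n \<gamma>" and i: "i \<le> n" and m: "\<gamma> i \<le> - int m"
  shows "(\<Sum>x=1..m. c - \<bar>f (- int x)\<bar>) \<le> cost c b f \<gamma> 0 n"
proof -
  have "lazy_walk n (\<lambda>i. - \<gamma> i)"
    using \<gamma> by (auto simp: lazy_walk_def abs_if split: if_splits)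
  from cost_ge_sites[OF admissible_env_reflect[OF env] this i, of m] m
  show ?thesis by (simp add: cost_def)
qed

lemma cost_pairs:
  "cost c b f \<gamma> 0 (2 * m) =
    (\<Sum>j<m. (c + b (int (2*j+1)) * f (\<gamma> (2*j+1))) + (c + b (int (2*j+2)) * f (\<gamma> (2*j+2))))"
proof (induction m)
  case 0 then show ?case by (simp add: cost_def)
next
  case (Suc m)
  have "cost c b f \<gamma> 0 (2 * Suc m) = cost c b f \<gamma> 0 (2 * m) + cost c b f \<gamma> (2*m) (2 * Suc m)"
    by (rule cost_split) auto
  moreover have "{2*m<..2 * Suc m} = {2*m+1, 2*m+2}" by auto
  then have "cost c b f \<gamma> (2*m) (2 * Suc m) =
      (c + b (int (2*m+1)) * f (\<gamma> (2*m+1))) + (c + b (int (2*m+2)) * f (\<gamma> (2*m+2)))"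
    by (simp add: cost_def)
  ultimately show ?case by (simp only: Suc sum.lessThan_Suc)
qed

text \<open>Two consecutive steps with opposite signs, at sites \<open>x\<close> and
  \<open>y\<close>, cost at least \<open>2 * c - \<bar>f x - f y\<bar>\<close>. The sites are equal
  or adjacent, so this is at least the smallest gap on the range. Disjoint pairs of times are used
  so that the sign changes will be independent.\<close>

lemma cost_ge_changes:
  assumes env: "admissible_env c b f" and \<gamma>: "lazy_walk n \<gamma>" and l: "is_ell c f n \<gamma> l"
  shows "dgap c f l * (\<Sum>j<n div 2. if b (int (2*j+1)) \<noteq> b (int (2*j+2)) then 1 else 0) \<le> cost c b f \<gamma> 0 n"
proof -
  have dg: "dgap c f l \<le> 2 * c" by (simp add: dgap_def)
  have pair: "dgap c f l * (if b (int (2*j+1)) \<noteq> b (int (2*j+2)) then 1 else 0) \<le>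
      (c + b (int (2*j+1)) * f (\<gamma> (2*j+1))) + (c + b (int (2*j+2)) * f (\<gamma> (2*j+2)))" (is "_ \<le> ?u + ?v")
    if j: "j < n div 2" for j
  proof (cases "b (int (2*j+1)) = b (int (2*j+2))")
    case True
    then show ?thesis
      using admissible_env_step_bounds(3)[OF env, of "int (2*j+1)" "\<gamma> (2*j+1)"]
        admissible_env_step_bounds(3)[OF env, of "int (2*j+2)" "\<gamma> (2*j+2)"] by simp
  next
    case False
    define x y where "x = \<gamma> (2*j+1)" and "y = \<gamma> (2*j+2)"
    have bb: "(b (int (2*j+1)) = 1 \<and> b (int (2*j+2)) = -1) \<or> (b (int (2*j+1)) = -1 \<and> b (int (2*j+2)) = 1)"
      using env False by (metis admissible_env_def)
    \<comment> \<open>An edge is indexed by its left endpoint, and either of the two sites may be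
      the left one.\<close>
    have xr: "x \<in> \<gamma> ` {0..n}" "y \<in> \<gamma> ` {0..n}"
      unfolding x_def y_def using j by (auto intro!: imageI)
    have xy: "\<bar>y - x\<bar> \<le> 1"
      using \<gamma> j by (auto simp: lazy_walk_def x_def y_def)
    have "dgap c f l \<le> 2 * c - \<bar>f x - f y\<bar>"
    proof -
      consider "y = x" | "y = x + 1" | "x = y + 1" using xy by linarith
      then show ?thesis
      proof cases
        case 1 then show ?thesis using dg by simp
      next
        case 2
        then have "dgap c f l \<le> dgap c f x" using l xr by (auto simp: is_ell_def)
        then show ?thesis using 2 by (simp add: dgap_def abs_minus_commute)
      next
        case 3
        then have "dgap c f l \<le> dgap c f y" using l xr by (auto simp: is_ell_def)
        then show ?thesis using 3 by (simp add: dgap_def)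
      qed
    qed
    also have "\<dots> \<le> ?u + ?v"
      using bb unfolding x_def[symmetric] y_def[symmetric] by auto
    finally show ?thesis using False by simp
  qed
  have "dgap c f l * (\<Sum>j<n div 2. if b (int (2*j+1)) \<noteq> b (int (2*j+2)) then 1 else 0) \<le>
    (\<Sum>j<n div 2. (c + b (int (2*j+1)) * f (\<gamma> (2*j+1))) + (c + b (int (2*j+2)) * f (\<gamma> (2*j+2))))"
    unfolding sum_distrib_left by (intro sum_mono pair) simp
  also have "\<dots> = cost c b f \<gamma> 0 (2 * (n div 2))"
    by (rule cost_pairs[symmetric])
  also have "\<dots> \<le> cost c b f \<gamma> 0 n"
    using cost_split[of 0 "2 * (n div 2)" n c b f \<gamma>] cost_nonneg[OF env, of \<gamma> "2 * (n div 2)" n] by simp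
  finally show ?thesis .
qed

section \<open>A competitor and the optimality of prefixes\<close>

text \<open>After reaching the edge the walk chooses its endpoint by the current sign:
  \<open>p + 1\<close>, where \<open>f\<close> is near \<open>- c\<close>, for sign 1, and
  \<open>p\<close>, where \<open>f\<close> is near \<open>c\<close>, for sign -1. Every such step
  costs at most \<open>e\<close>.\<close>

lemma walk_to_edge:
  assumes env: "admissible_env c b f" and e: "f (int p) > c - e" "f (int p + 1) < - c + e" and e0: "e \<ge> 0"
  obtains \<gamma> where "lazy_walk n \<gamma>" "cost c b f \<gamma> 0 n \<le> 2 * c * real p + e * real n" "\<bar>\<gamma> n\<bar> \<le> int p + 1"
proof -
  define \<gamma> where "\<gamma> i = (if i \<le> p then int i else if b (int i) = 1 then int p + 1 else int p)" for i
  have c0: "c \<ge> 0" using env by (auto simp: admissible_env_def intro: order_trans[OF abs_ge_zero])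
  have w: "lazy_walk n \<gamma>" by (auto simp: lazy_walk_def \<gamma>_def)
  have step: "c + b (int i) * f (\<gamma> i) \<le> (if i \<le> p then 2 * c else 0) + e" for i
  proof (cases "i \<le> p")
    case True then show ?thesis
      using admissible_env_step_bounds(2)[OF env, of "int i" "\<gamma> i"] e0 by simp
  next
    case False
    have "b (int i) = 1 \<or> b (int i) = -1" using env by (auto simp: admissible_env_def)
    then show ?thesis using False e e0 by (auto simp: \<gamma>_def)
  qed
  have "cost c b f \<gamma> 0 n \<le> (\<Sum>i\<in>{0<..n}. (if i \<le> p then 2 * c else 0) + e)"
    unfolding cost_def by (intro sum_mono step)
  also have "\<dots> = (\<Sum>i\<in>{0<..n}. (if i \<le> p then 2 * c else 0)) + e * real n"
    by (simp add: sum.distrib)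
  also have "(\<Sum>i\<in>{0<..n}. (if i \<le> p then 2 * c else 0)) = (\<Sum>i\<in>{0<..n} \<inter> {i. i \<le> p}. 2 * c)"
    by (subst sum.inter_restrict) auto
  also have "\<dots> \<le> (\<Sum>i\<in>{0<..p}. 2 * c)"
    using c0 by (intro sum_mono2) auto
  also have "\<dots> = 2 * c * real p" by simp
  finally have "cost c b f \<gamma> 0 n \<le> 2 * c * real p + e * real n" by simp
  moreover have "\<bar>\<gamma> n\<bar> \<le> int p + 1" by (auto simp: \<gamma>_def)
  ultimately show ?thesis using w by (intro that[of \<gamma>])
qed

lemma free_minimizer_cost_le:
  assumes "free_minimizer b f n \<gamma>" "lazy_walk n \<beta>"
  shows "cost c b f \<gamma> 0 n \<le> cost c b f \<beta> 0 n"
  using assms by (auto simp: free_minimizer_def cost_0_eq_action)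

text \<open>Replacing the initial piece by a cheaper walk to the same point would improve the whole.
  This identifies the cost of both the first leg and the piece up to time \<open>T\<close> with an
  excess.\<close>

lemma free_minimizer_prefix:
  assumes min: "free_minimizer b f n \<gamma>" and t: "t \<le> n"
  shows "cost c b f \<gamma> 0 t = excess c b f t (\<gamma> t)"
proof (rule antisym)
  have w: "lazy_walk n \<gamma>" using min by (simp add: free_minimizer_def)
  obtain \<beta> where \<beta>: "lazy_walk t \<beta>" "\<beta> t = \<gamma> t" "excess c b f t (\<gamma> t) = cost c b f \<beta> 0 t"
    using excess_attained[OF lazy_walk_le[OF w t]] .
  define \<delta> where "\<delta> i = (if i \<le> t then \<beta> i else \<gamma> i)" for i
  have "\<bar>\<delta> (Suc i) - \<delta> i\<bar> \<le> 1" if "i < n" for i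
  proof -
    consider "i < t" | "i = t" | "i > t" by linarith
    then show ?thesis
    proof cases
      case 1 then show ?thesis using \<beta>(1) by (simp add: \<delta>_def lazy_walk_def)
    next
      case 2
      then show ?thesis using w that \<beta>(2) by (simp add: \<delta>_def lazy_walk_def)
    next
      case 3
      then show ?thesis using w that by (simp add: \<delta>_def lazy_walk_def)
    qed
  qed
  then have "lazy_walk n \<delta>"
    using \<beta>(1) by (auto simp: lazy_walk_def \<delta>_def)
  from free_minimizer_cost_le[OF min this, of c]
  have "cost c b f \<gamma> 0 t + cost c b f \<gamma> t n \<le> cost c b f \<delta> 0 t + cost c b f \<delta> t n"
    using t by (simp add: cost_split[of 0 t n])
  moreover have "cost c b f \<delta> 0 t = cost c b f \<beta> 0 t"
    by (rule cost_cong) (simp add: \<delta>_def)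
  moreover have "cost c b f \<delta> t n = cost c b f \<gamma> t n"
    by (rule cost_cong) (simp add: \<delta>_def)
  ultimately show "cost c b f \<gamma> 0 t \<le> excess c b f t (\<gamma> t)" using \<beta>(3) by simp
  show "excess c b f t (\<gamma> t) \<le> cost c b f \<gamma> 0 t"
    using w t by (intro excess_le_cost) (auto simp: lazy_walk_def)
qed

subsection \<open>Uniform bounds from the shape function\<close>

definition shape_limit :: "real \<Rightarrow> (int \<Rightarrow> real) \<Rightarrow> (int \<Rightarrow> real) \<Rightarrow> (real \<Rightarrow> real) \<Rightarrow> real \<Rightarrow> bool" where
  "shape_limit c b f G \<alpha> \<longleftrightarrow> (\<lambda>n. excess c b f n (round0 (\<alpha> * real n)) / real n) \<longlonglongrightarrow> G \<alpha>"

lemma round0_nonneg: "0 \<le> x \<Longrightarrow> round0 x = \<lfloor>x\<rfloor>"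
  by (simp add: round0_def)

lemma admissible_env_c_nonneg: "admissible_env c b f \<Longrightarrow> 0 \<le> c"
  by (auto simp: admissible_env_def intro: order_trans[OF abs_ge_zero])

lemma round0_le:
  assumes "0 \<le> \<alpha>" "\<alpha> \<le> 1" shows "\<bar>round0 (\<alpha> * real n)\<bar> \<le> int n"
proof -
  have "\<alpha> * real n \<le> real n" using assms by (simp add: mult_left_le_one_le)
  then have "\<lfloor>\<alpha> * real n\<rfloor> \<le> int n" by linarith
  then show ?thesis using assms by (simp add: round0_nonneg)
qed

text \<open>Convergence is given only along a grid of slopes. An arbitrary \<open>x\<close> is
  compared with a grid ray just below it: a walk to \<open>x\<close> can be prolonged onto the ray
  at small expense, so a cheap walk to \<open>x\<close> would undercut the limit along the
  ray.\<close>

lemma excess_ge_line_pos: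
  fixes G :: "real \<Rightarrow> real"
  assumes env: "admissible_env c b f" and \<sigma>: "0 \<le> \<sigma>" and m: "0 \<le> m" and \<epsilon>: "0 < \<epsilon>"
    and conv: "\<And>j H. \<sigma> + real j / real (Suc H) \<le> 1 \<Longrightarrow> shape_limit c b f G (\<sigma> + real j / real (Suc H))"
    and G: "\<And>\<alpha>. \<sigma> \<le> \<alpha> \<Longrightarrow> \<alpha> \<le> 1 \<Longrightarrow> m * \<alpha> \<le> G \<alpha>"
  shows "\<exists>t0. \<forall>t\<ge>t0. \<forall>x. \<sigma> * real t \<le> real_of_int x \<and> x \<le> int t \<longrightarrow> m * real_of_int x - \<epsilon> * real t \<le> excess c b f t x"
proof -
  have c: "0 \<le> c" using admissible_env_c_nonneg[OF env] .
  obtain H :: nat where H: "8 * (m + 2 * c + 1) / \<epsilon> < real H" using reals_Archimedean2 by blast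
  define h where "h = 1 / real (Suc H)"
  have h0: "0 < h" "h \<le> 1" by (auto simp: h_def)
  have hs: "(m + 2 * c) * h \<le> \<epsilon> / 8"
  proof -
    have "8 * (m + 2 * c) \<le> \<epsilon> * real (Suc H)"
      using H \<epsilon> by (simp add: field_simps)
    then show ?thesis by (simp add: h_def field_simps)
  qed
  define J where "J = {j. j \<le> Suc H \<and> \<sigma> + real j / real (Suc H) \<le> 1}"
  have finJ: "finite J" by (simp add: J_def)
  have "eventually (\<lambda>n. \<forall>j\<in>J. G (\<sigma> + real j * h) - \<epsilon> / 16 < excess c b f n (round0 ((\<sigma> + real j * h) * real n)) / real n) sequentially"
  proof (rule eventually_ball_finite[OF finJ], rule ballI)
    fix j assume "j \<in> J"
    then have "shape_limit c b f G (\<sigma> + real j * h)"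
      using conv[of j H] by (simp add: J_def h_def)
    then show "eventually (\<lambda>n. G (\<sigma> + real j * h) - \<epsilon> / 16 < excess c b f n (round0 ((\<sigma> + real j * h) * real n)) / real n) sequentially"
      unfolding shape_limit_def by (rule order_tendstoD(1)) (use \<epsilon> in simp)
  qed
  then obtain t1 where t1: "\<And>n j. n \<ge> t1 \<Longrightarrow> j \<in> J \<Longrightarrow> 
      G (\<sigma> + real j * h) - \<epsilon> / 16 < excess c b f n (round0 ((\<sigma> + real j * h) * real n)) / real n"
    unfolding eventually_sequentially by blast
  define t0 where "t0 = max t1 (max 1 (nat \<lceil>8 * c / \<epsilon>\<rceil>))"
  show ?thesis
  proof (intro exI[of _ t0] allI impI)
    fix t :: nat and x :: int
    assume t: "t \<ge> t0" and "\<sigma> * real t \<le> real_of_int x \<and> x \<le> int t"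
    then have x: "\<sigma> * real t \<le> real_of_int x" "x \<le> int t" by auto
    have t_ge: "t \<ge> t1" "t \<ge> 1" "real t \<ge> 8 * c / \<epsilon>" using t by (auto simp: t0_def)
    have tp: "real t > 0" using t_ge by simp
    have x0: "0 \<le> x" using x \<sigma> tp by (smt (verit) mult_nonneg_nonneg of_int_0_le_iff)
    define v where "v = real_of_int x / real t"
    have v: "\<sigma> \<le> v" "v \<le> 1" "v * real t = real_of_int x"
      using x tp by (auto simp: v_def field_simps)
    \<comment> \<open>The slope is rounded down on a grid that begins at \<open>\<sigma>\<close>, so
      it stays in the range where the bound on \<open>G\<close> is assumed.\<close>
    define j where "j = nat \<lfloor>(v - \<sigma>) * real (Suc H)\<rfloor>"
    have j: "real j \<le> (v - \<sigma>) * real (Suc H)" "(v - \<sigma>) * real (Suc H) < real j + 1"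
      using v by (auto simp: j_def)
    define \<alpha> where "\<alpha> = \<sigma> + real j * h"
    have \<alpha>: "\<sigma> \<le> \<alpha>" "\<alpha> \<le> v" "v \<le> \<alpha> + h"
      using j h0 by (auto simp: \<alpha>_def h_def field_simps)
    have "\<alpha> \<le> 1" using \<alpha> v by linarith
    have jJ: "j \<in> J"
    proof -
      have "(v - \<sigma>) * real (Suc H) \<le> 1 * real (Suc H)"
        using v \<sigma> by (intro mult_right_mono) auto
      then have "real j \<le> real (Suc H)" using order_trans[OF j(1)] by simp
      moreover have "\<sigma> + real j / real (Suc H) \<le> 1" using \<open>\<alpha> \<le> 1\<close> by (simp add: \<alpha>_def h_def)
      ultimately show ?thesis unfolding J_def by (simp only: of_nat_le_iff mem_Collect_eq)
    qed
    \<comment> \<open>At time \<open>t\<close> the ray lags behind \<open>x\<close> by at most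
      \<open>h * real t\<close>, and rounding adds 1; \<open>r\<close> further steps cover this, and
      also the case that the advancing ray overtakes \<open>x\<close>.\<close>
    define r where "r = nat \<lceil>h * real t\<rceil> + 1"
    have r: "real r \<ge> h * real t + 1" "real r \<le> h * real t + 2"
      using mult_nonneg_nonneg[of h "real t"] h0 unfolding r_def by simp_all linarith+
    define t' where "t' = t + r"
    define k where "k = round0 (\<alpha> * real t')"
    have \<alpha>0: "0 \<le> \<alpha>" using \<alpha> \<sigma> by linarith
    have k: "real_of_int k \<le> \<alpha> * real t'" "\<alpha> * real t' - 1 \<le> real_of_int k"
      using \<alpha>0 unfolding k_def by (simp_all add: round0_nonneg)
    have at': "\<alpha> * real t' = \<alpha> * real t + \<alpha> * real r" by (simp add: t'_def algebra_simps)
    have ar: "\<alpha> * real r \<le> real r" "0 \<le> \<alpha> * real r" using \<alpha>0 \<open>\<alpha> \<le> 1\<close> by (auto simp: mult_left_le_one_le)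
    have at: "\<alpha> * real t \<le> real_of_int x" "real_of_int x \<le> \<alpha> * real t + h * real t"
      using mult_right_mono[OF \<alpha>(2), of "real t"] mult_right_mono[OF \<alpha>(3), of "real t"] v(3) tp
      by (auto simp: algebra_simps)
    have "\<bar>real_of_int (k - x)\<bar> \<le> real r"
      using k at' ar at r unfolding of_int_diff by linarith
    then have kx: "\<bar>k - x\<bar> \<le> int (t' - t)" unfolding t'_def by (simp flip: of_int_abs)
    have "excess c b f t' k \<le> excess c b f t x + 2 * c * real (t' - t)"
      using x x0 kx by (intro excess_extend[OF env]) (auto simp: t'_def)
    then have 1: "excess c b f t' k \<le> excess c b f t x + 2 * c * real r" by (simp add: t'_def)
    have t'p: "real t' > 0" using tp by (simp add: t'_def)
    have "G \<alpha> - \<epsilon> / 16 < excess c b f t' k / real t'"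
      using t1[of t' j] t_ge jJ by (simp add: t'_def k_def \<alpha>_def)
    then have 2: "(G \<alpha> - \<epsilon> / 16) * real t' \<le> excess c b f t' k"
      using t'p by (simp add: field_simps)
    have "m * \<alpha> * real t' \<le> G \<alpha> * real t'"
      using G[OF \<alpha>(1) \<open>\<alpha> \<le> 1\<close>] t'p by (intro mult_right_mono) auto
    moreover have "m * (\<alpha> * real t) \<le> m * (\<alpha> * real t')"
      using m \<alpha>0 by (intro mult_left_mono) (auto simp: t'_def)
    moreover have "m * (real_of_int x - h * real t) \<le> m * (\<alpha> * real t)"
      using m at by (intro mult_left_mono) auto
    ultimately have 3: "m * real_of_int x - m * h * real t \<le> G \<alpha> * real t'" by (simp add: algebra_simps)
    have "h * real t \<le> real t" using h0 tp by simp
    then have "real t' \<le> 4 * real t" using r t_ge(2) unfolding t'_def of_nat_add by linarith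
    then have 4: "\<epsilon> / 16 * real t' \<le> \<epsilon> / 4 * real t"
      using \<epsilon> by (simp add: field_simps)
    have 5: "2 * c * real r \<le> 2 * c * h * real t + 4 * c"
      using mult_left_mono[OF r(2), of "2 * c"] c by (simp add: algebra_simps)
    have 6: "(m + 2 * c) * h * real t \<le> \<epsilon> / 8 * real t"
      using hs tp by (intro mult_right_mono) auto
    have 7: "4 * c \<le> \<epsilon> / 2 * real t" using t_ge(3) \<epsilon> by (simp add: field_simps)
    have 8: "0 \<le> \<epsilon> * real t" using \<epsilon> by simp
    show "m * real_of_int x - \<epsilon> * real t \<le> excess c b f t x"
      using 1 2 3 4 5 6 7 8 by (simp add: algebra_simps)
  qed
qed

text \<open>The reverse of the previous argument: follow a grid ray until shortly before
  \<open>t\<close> and use the remaining steps to reach \<open>x\<close>.\<close>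

lemma excess_le_line_pos:
  fixes G :: "real \<Rightarrow> real"
  assumes env: "admissible_env c b f" and \<sigma>: "\<sigma> \<le> 1 / 4" and m: "0 \<le> m" and \<epsilon>: "0 < \<epsilon>"
    and conv: "\<And>j H. real j / real (Suc H) \<le> 1 \<Longrightarrow> shape_limit c b f G (real j / real (Suc H))"
    and G: "\<And>\<alpha>. 0 \<le> \<alpha> \<Longrightarrow> \<alpha> \<le> \<sigma> \<Longrightarrow> G \<alpha> \<le> m * \<alpha>"
  shows "\<exists>t0. \<forall>t\<ge>t0. \<forall>x. 0 \<le> x \<and> real_of_int x \<le> \<sigma> * real t \<longrightarrow> excess c b f t x \<le> m * real_of_int x + \<epsilon> * real t"
proof -
  have c: "0 \<le> c" using admissible_env_c_nonneg[OF env] .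
  obtain H :: nat where H: "max 8 (16 * (c + 1) / \<epsilon>) < real H" using reals_Archimedean2 by blast
  define h where "h = 1 / real (Suc H)"
  have h0: "0 < h" "h \<le> 1 / 8" using H by (auto simp: h_def field_simps)
  have hs: "c * h \<le> \<epsilon> / 16"
  proof -
    have "16 * c \<le> \<epsilon> * real (Suc H)"
      using H \<epsilon> c by (simp add: field_simps)
    then show ?thesis by (simp add: h_def field_simps)
  qed
  define J where "J = {j. j \<le> Suc H}"
  have finJ: "finite J" by (simp add: J_def)
  have "eventually (\<lambda>n. \<forall>j\<in>J. excess c b f n (round0 ((real j * h) * real n)) / real n < G (real j * h) + \<epsilon> / 4) sequentially"
  proof (rule eventually_ball_finite[OF finJ], rule ballI)
    fix j assume "j \<in> J"
    then have "shape_limit c b f G (real j * h)"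
      using conv[of j H] by (simp add: J_def h_def)
    then show "eventually (\<lambda>n. excess c b f n (round0 ((real j * h) * real n)) / real n < G (real j * h) + \<epsilon> / 4) sequentially"
      unfolding shape_limit_def by (rule order_tendstoD(2)) (use \<epsilon> in simp)
  qed
  then obtain t1 where t1: "\<And>n j. n \<ge> t1 \<Longrightarrow> j \<in> J \<Longrightarrow> 
      excess c b f n (round0 ((real j * h) * real n)) / real n < G (real j * h) + \<epsilon> / 4"
    unfolding eventually_sequentially by blast
  define t0 where "t0 = max (2 * t1) (max 16 (nat \<lceil>16 * c / \<epsilon>\<rceil>))"
  show ?thesis
  proof (intro exI[of _ t0] allI impI)
    fix t :: nat and x :: int
    assume t: "t \<ge> t0" and "0 \<le> x \<and> real_of_int x \<le> \<sigma> * real t"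
    then have x: "0 \<le> x" "real_of_int x \<le> \<sigma> * real t" by auto
    have t_ge: "t \<ge> 2 * t1" "real t \<ge> 16" "real t \<ge> 16 * c / \<epsilon>" using t by (auto simp: t0_def)
    have tp: "real t > 0" using t_ge by simp
    define v where "v = real_of_int x / real t"
    have v: "0 \<le> v" "v \<le> \<sigma>" "v * real t = real_of_int x"
      using x tp by (auto simp: v_def field_simps)
    define j where "j = nat \<lfloor>v * real (Suc H)\<rfloor>"
    have j: "real j \<le> v * real (Suc H)" "v * real (Suc H) < real j + 1"
      using v by (auto simp: j_def)
    define \<alpha> where "\<alpha> = real j * h"
    have \<alpha>: "0 \<le> \<alpha>" "\<alpha> \<le> v" "v \<le> \<alpha> + h"
      using j h0 by (auto simp: \<alpha>_def h_def field_simps)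
    have \<alpha>4: "\<alpha> \<le> 1 / 4" "\<alpha> \<le> \<sigma>" using \<alpha> v \<sigma> by linarith+
    have jJ: "j \<in> J"
    proof -
      have "v * real (Suc H) \<le> 1 * real (Suc H)"
        using v \<sigma> by (intro mult_right_mono) auto
      then have "real j \<le> real (Suc H)" using order_trans[OF j(1)] by simp
      then show ?thesis unfolding J_def by (simp only: of_nat_le_iff mem_Collect_eq)
    qed
    \<comment> \<open>When the ray is left, \<open>x\<close> may be
      \<open>\<alpha> * r + h * t + 1\<close> away. Slopes are at most 1/4, so the first term is at
      most \<open>r / 2\<close>, and \<open>2 * (h * t + 1)\<close> steps suffice. The choice of
      \<open>h\<close> and \<open>t0\<close> keeps \<open>r \<le> t / 2\<close>.\<close>
    define r where "r = 2 * nat \<lceil>h * real t\<rceil> + 2"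
    have "h * real t \<ge> 0" using h0 by simp
    then have r: "real r \<ge> 2 * (h * real t) + 2" "real r \<le> 2 * (h * real t) + 4"
      unfolding r_def by simp_all linarith+
    have "h * real t \<le> real t / 8" using h0 tp by (simp add: field_simps)
    then have r2: "real r \<le> real t / 2" using r t_ge by linarith
    define t' where "t' = t - r"
    have rt: "r \<le> t" using r2 by linarith
    have t': "real t' = real t - real r" using rt by (simp add: t'_def)
    have t't1: "t' \<ge> t1" "real t' > 0" using t' r2 t_ge(1,2) by linarith+
    define k where "k = round0 (\<alpha> * real t')"
    have k: "real_of_int k \<le> \<alpha> * real t'" "\<alpha> * real t' - 1 \<le> real_of_int k"
      using \<alpha>(1) unfolding k_def by (simp_all add: round0_nonneg)
    have at': "\<alpha> * real t' = \<alpha> * real t - \<alpha> * real r" by (simp add: t' algebra_simps)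
    have ar: "\<alpha> * real r \<le> real r / 2" "0 \<le> \<alpha> * real r" 
      using \<alpha>(1) mult_right_mono[OF \<alpha>4(1), of "real r"] by auto
    have at: "\<alpha> * real t \<le> real_of_int x" "real_of_int x \<le> \<alpha> * real t + h * real t"
      using mult_right_mono[OF \<alpha>(2), of "real t"] mult_right_mono[OF \<alpha>(3), of "real t"] v(3) tp
      by (auto simp: algebra_simps)
    have "\<bar>real_of_int (x - k)\<bar> \<le> real r"
      using k at' ar at r unfolding of_int_diff by linarith
    then have kx: "\<bar>x - k\<bar> \<le> int (t - t')" using rt unfolding t'_def by (simp flip: of_int_abs)
    have "0 \<le> k" using \<alpha>(1) by (simp add: k_def round0_nonneg)
    moreover have "\<alpha> * real t' \<le> real t'" using \<alpha>4 \<alpha>(1) by (simp add: mult_left_le_one_le)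
    then have "k \<le> int t'" using k by linarith
    ultimately have "excess c b f t x \<le> excess c b f t' k + 2 * c * real (t - t')"
      using kx by (intro excess_extend[OF env]) (auto simp: t'_def)
    then have 1: "excess c b f t x \<le> excess c b f t' k + 2 * c * real r" using rt by (simp add: t'_def)
    have "excess c b f t' k / real t' < G \<alpha> + \<epsilon> / 4"
      using t1[of t' j] t't1 jJ by (simp add: k_def \<alpha>_def)
    then have 2: "excess c b f t' k \<le> (G \<alpha> + \<epsilon> / 4) * real t'"
      using t't1 by (simp add: field_simps)
    have "G \<alpha> * real t' \<le> m * \<alpha> * real t'"
      using G[OF \<alpha>(1) \<alpha>4(2)] by (intro mult_right_mono) auto
    moreover have "m * (\<alpha> * real t') \<le> m * (\<alpha> * real t)"
      using m \<alpha>(1) t' by (intro mult_left_mono) auto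
    moreover have "m * (\<alpha> * real t) \<le> m * real_of_int x"
      using m at by (intro mult_left_mono) auto
    ultimately have 3: "G \<alpha> * real t' \<le> m * real_of_int x" by (simp add: algebra_simps)
    have 4: "\<epsilon> / 4 * real t' \<le> \<epsilon> / 4 * real t"
      using \<epsilon> t' by (intro mult_left_mono) auto
    have 5: "2 * c * real r \<le> 4 * (c * h) * real t + 8 * c"
      using mult_left_mono[OF r(2), of "2 * c"] c by (simp add: algebra_simps)
    have 6: "(c * h) * real t \<le> \<epsilon> / 16 * real t"
      using hs tp by (intro mult_right_mono) auto
    have 7: "8 * c \<le> \<epsilon> / 2 * real t" using t_ge(3) \<epsilon> by (simp add: field_simps)
    have "excess c b f t x \<le> G \<alpha> * real t' + \<epsilon> / 4 * real t' + 2 * c * real r"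
      using 1 2 by (simp add: algebra_simps)
    then show "excess c b f t x \<le> m * real_of_int x + \<epsilon> * real t"
      using 3 4 5 6 7 by simp
  qed
qed

text \<open>Both directions of travel are covered. The threshold \<open>t0\<close> is explicit and
  the condition is monotone in it, so that the probability at a deterministic, growing threshold can
  be sent to 1.\<close>

definition excess_above :: "real \<Rightarrow> (int \<Rightarrow> real) \<Rightarrow> (int \<Rightarrow> real) \<Rightarrow> real \<Rightarrow> real \<Rightarrow> real \<Rightarrow> nat \<Rightarrow> bool" where
  "excess_above c b f \<sigma> m \<epsilon> t0 \<longleftrightarrow> (\<forall>t\<ge>t0. \<forall>x. \<sigma> * real t \<le> real_of_int \<bar>x\<bar> \<and> \<bar>x\<bar> \<le> int t \<longrightarrow>
     m * real_of_int \<bar>x\<bar> - \<epsilon> * real t \<le> excess c b f t x)"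

definition excess_below :: "real \<Rightarrow> (int \<Rightarrow> real) \<Rightarrow> (int \<Rightarrow> real) \<Rightarrow> real \<Rightarrow> real \<Rightarrow> real \<Rightarrow> nat \<Rightarrow> bool" where
  "excess_below c b f \<sigma> m \<epsilon> t0 \<longleftrightarrow> (\<forall>t\<ge>t0. \<forall>x. real_of_int \<bar>x\<bar> \<le> \<sigma> * real t \<longrightarrow>
     excess c b f t x \<le> m * real_of_int \<bar>x\<bar> + \<epsilon> * real t)"

lemma excess_above_mono: "excess_above c b f \<sigma> m \<epsilon> t \<Longrightarrow> t \<le> t' \<Longrightarrow> excess_above c b f \<sigma> m \<epsilon> t'"
  by (auto simp: excess_above_def)

lemma excess_below_mono: "excess_below c b f \<sigma> m \<epsilon> t \<Longrightarrow> t \<le> t' \<Longrightarrow> excess_below c b f \<sigma> m \<epsilon> t'"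
  by (auto simp: excess_below_def)

lemma excess_above_exists:
  fixes G :: "real \<Rightarrow> real"
  assumes env: "admissible_env c b f" and \<sigma>: "0 \<le> \<sigma>" and m: "0 \<le> m" and \<epsilon>: "0 < \<epsilon>"
    and conv: "\<And>j H. \<sigma> + real j / real (Suc H) \<le> 1 \<Longrightarrow> shape_limit c b f G (\<sigma> + real j / real (Suc H))"
    and conv': "\<And>j H. \<sigma> + real j / real (Suc H) \<le> 1 \<Longrightarrow> shape_limit c b (\<lambda>x. f (- x)) G (\<sigma> + real j / real (Suc H))"
    and G: "\<And>\<alpha>. \<sigma> \<le> \<alpha> \<Longrightarrow> \<alpha> \<le> 1 \<Longrightarrow> m * \<alpha> \<le> G \<alpha>"
  shows "\<exists>t0. excess_above c b f \<sigma> m \<epsilon> t0"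
proof -
  from excess_ge_line_pos[OF env \<sigma> m \<epsilon> conv G] obtain t1 where
    t1: "\<And>t x. t\<ge>t1 \<Longrightarrow> \<sigma> * real t \<le> real_of_int x \<Longrightarrow> x \<le> int t \<Longrightarrow> m * real_of_int x - \<epsilon> * real t \<le> excess c b f t x"
    by auto
  from excess_ge_line_pos[OF admissible_env_reflect[OF env] \<sigma> m \<epsilon> conv' G] obtain t2 where
    t2: "\<And>t x. t\<ge>t2 \<Longrightarrow> \<sigma> * real t \<le> real_of_int x \<Longrightarrow> x \<le> int t \<Longrightarrow> m * real_of_int x - \<epsilon> * real t \<le> excess c b f t (- x)"
    unfolding excess_reflect by auto
  have "m * real_of_int \<bar>x\<bar> - \<epsilon> * real t \<le> excess c b f t x"
    if "t \<ge> max t1 t2" "\<sigma> * real t \<le> real_of_int \<bar>x\<bar>" "\<bar>x\<bar> \<le> int t" for t x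
    using t1[of t x] t2[of t "- x"] that by (cases "x \<ge> 0") auto
  then show ?thesis unfolding excess_above_def by blast
qed

lemma excess_below_exists:
  fixes G :: "real \<Rightarrow> real"
  assumes env: "admissible_env c b f" and \<sigma>: "\<sigma> \<le> 1 / 4" and m: "0 \<le> m" and \<epsilon>: "0 < \<epsilon>"
    and conv: "\<And>j H. real j / real (Suc H) \<le> 1 \<Longrightarrow> shape_limit c b f G (real j / real (Suc H))"
    and conv': "\<And>j H. real j / real (Suc H) \<le> 1 \<Longrightarrow> shape_limit c b (\<lambda>x. f (- x)) G (real j / real (Suc H))"
    and G: "\<And>\<alpha>. 0 \<le> \<alpha> \<Longrightarrow> \<alpha> \<le> \<sigma> \<Longrightarrow> G \<alpha> \<le> m * \<alpha>"
  shows "\<exists>t0. excess_below c b f \<sigma> m \<epsilon> t0"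
proof -
  from excess_le_line_pos[OF env \<sigma> m \<epsilon> conv G] obtain t1 where
    t1: "\<And>t x. t\<ge>t1 \<Longrightarrow> 0 \<le> x \<Longrightarrow> real_of_int x \<le> \<sigma> * real t \<Longrightarrow> excess c b f t x \<le> m * real_of_int x + \<epsilon> * real t"
    by auto
  from excess_le_line_pos[OF admissible_env_reflect[OF env] \<sigma> m \<epsilon> conv' G] obtain t2 where
    t2: "\<And>t x. t\<ge>t2 \<Longrightarrow> 0 \<le> x \<Longrightarrow> real_of_int x \<le> \<sigma> * real t \<Longrightarrow> excess c b f t (- x) \<le> m * real_of_int x + \<epsilon> * real t"
    unfolding excess_reflect by auto
  have "excess c b f t x \<le> m * real_of_int \<bar>x\<bar> + \<epsilon> * real t"
    if "t \<ge> max t1 t2" "real_of_int \<bar>x\<bar> \<le> \<sigma> * real t" for t x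
    using t1[of t x] t2[of t "- x"] that by (cases "x \<ge> 0") auto
  then show ?thesis unfolding excess_below_def by blast
qed

section \<open>Deterministic estimates for the minimizer\<close>

lemma tau_props:
  assumes "is_ell c f n \<gamma> l"
  shows "tau \<gamma> l \<le> n" "\<gamma> (tau \<gamma> l) \<in> {l, l + 1}"
proof -
  obtain i where i: "i \<le> n" "\<gamma> i = l" using assms by (auto simp: is_ell_def)
  then show "tau \<gamma> l \<le> n" unfolding tau_def by (intro order_trans[OF Least_le[of _ i]]) auto
  show "\<gamma> (tau \<gamma> l) \<in> {l, l + 1}" unfolding tau_def by (rule LeastI[of _ i]) (use i in auto)
qed

text \<open>The second leg of the minimizer is bounded from below by comparing it with a path that starts
  at the origin already at time \<open>- T\<close>: such a path reaches the endpoint of the first leg at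
  nearly the minimal cost \<open>g\<close> per unit length, because it has plenty of time.\<close>
lemma minimizer_first_leg_bound:
  assumes env: "admissible_env c b f" and K: "K > 1" and g: "0 \<le> g" and \<delta>: "0 \<le> \<delta>" and \<eta>: "0 \<le> \<eta>" and \<epsilon>: "0 \<le> \<epsilon>"
    and min: "free_minimizer b f n \<gamma>" and ell: "is_ell c f n \<gamma> l" and fast: "real (tau \<gamma> l) < K * real_of_int \<bar>l\<bar>"
    and T: "T \<le> n" "K * R \<le> real T" "R \<le> \<sigma> * real T" "0 \<le> \<sigma>" "t0 \<le> T"
    and R: "\<And>i. i \<le> n \<Longrightarrow> real_of_int \<bar>\<gamma> i\<bar> \<le> R"
    and t0: "real t0 \<le> real_of_int \<bar>l\<bar> - 1"
    and m: "K \<le> (K - 1) * real m"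
    and low: "excess_above c b f (1 / K) (g + \<delta>) \<epsilon> t0"
    and up: "excess_below c b f \<sigma> (g + \<eta>) \<epsilon> t0"
    and low': "excess_above c (\<lambda>i. b (i - int T)) f 0 g \<epsilon> t0"
    and up': "excess_below c (\<lambda>i. b (i - int T)) f \<sigma> (g + \<eta>) \<epsilon> t0"
  shows "\<delta> * (real_of_int \<bar>l\<bar> - 1) \<le> 2 * \<eta> * R + \<epsilon> * (6 * real T + real m) + 2 * c * real m"
proof -
  have w: "lazy_walk n \<gamma>" using min by (simp add: free_minimizer_def)
  have c: "0 \<le> c" using admissible_env_c_nonneg[OF env] .
  define s where "s = tau \<gamma> l"
  define y where "y = \<gamma> s"
  define x where "x = \<gamma> T"
  have sn: "s \<le> n" and yl: "y = l \<or> y = l + 1" using tau_props[OF ell] by (auto simp: s_def y_def)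
  have y_ge: "\<bar>y\<bar> \<ge> \<bar>l\<bar> - 1" using yl by linarith
  have ys: "\<bar>y\<bar> \<le> int s" using lazy_walk_le[OF w sn] by (simp add: y_def)
  have xT: "\<bar>x\<bar> \<le> int T" using lazy_walk_le[OF w T(1)] by (simp add: x_def)
  have l_range: "real_of_int \<bar>l\<bar> \<le> R"
    using ell R by (auto simp: is_ell_def)
  have yR: "real_of_int \<bar>y\<bar> \<le> R" and xR: "real_of_int \<bar>x\<bar> \<le> R" using R sn T by (auto simp: y_def x_def)
  have "K * real_of_int \<bar>l\<bar> \<le> K * R" using l_range K by (intro mult_left_mono) auto
  \<comment> \<open>The first leg ends before \<open>T\<close>, so it is a prefix of the piece
    considered.\<close>
  then have sT: "s \<le> T" using fast T(2) by (simp add: s_def)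
  have step: "\<bar>\<gamma> (Suc i) - \<gamma> i\<bar> \<le> 1" if "i < n" for i using w that by (auto simp: lazy_walk_def)
  \<comment> \<open>The first leg may end at \<open>l + 1\<close>, one site closer to the origin
    than \<open>l\<close>, and then its speed can be slightly below \<open>1 / K\<close>. Running
    \<open>m\<close> more steps straight outwards restores the speed, by
    \<open>K \<le> (K - 1) * m\<close>, at the bounded cost \<open>2 * c * m\<close>.\<close>
  define z where "z = (if y \<ge> 0 then y + int m else y - int m)"
  have z: "\<bar>z\<bar> = \<bar>y\<bar> + int m" by (auto simp: z_def)
  have zy: "\<bar>z - y\<bar> \<le> int m" by (auto simp: z_def)
  have ext: "excess c b f (s + m) z \<le> excess c b f s y + 2 * c * real m"
    using excess_extend[OF env, of s "s + m" y z] ys zy by simp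
  have slope: "1 / K * real (s + m) \<le> real_of_int \<bar>z\<bar>"
  proof -
    have "K * (real_of_int \<bar>l\<bar> - 1) \<le> K * real_of_int \<bar>y\<bar>"
      using y_ge K by (intro mult_left_mono) linarith+
    moreover have "real s < K * real_of_int \<bar>l\<bar>" using fast by (simp add: s_def)
    ultimately have "real (s + m) \<le> K * real_of_int \<bar>z\<bar>"
      using m unfolding z by (simp add: algebra_simps)
    then show ?thesis using K by (simp add: field_simps)
  qed
  have t0s: "t0 \<le> s + m" "t0 \<le> T + s" "t0 \<le> T + T" using t0 y_ge ys T(5) by linarith+
  have A: "(g + \<delta>) * real_of_int \<bar>z\<bar> - \<epsilon> * real (s + m) \<le> excess c b f (s + m) z"
  proof -
    have "\<bar>z\<bar> \<le> int (s + m)" using ys z by simp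
    then show ?thesis using low slope t0s(1) unfolding excess_above_def by blast
  qed
  have B: "excess c b f T x \<le> (g + \<eta>) * real_of_int \<bar>x\<bar> + \<epsilon> * real T"
    using up xR T unfolding excess_below_def by auto
  have C: "g * real_of_int \<bar>x\<bar> - \<epsilon> * real (T + T) \<le> excess c (\<lambda>i. b (i - int T)) f (T + T) x"
    using low' xT t0s unfolding excess_above_def by auto
  \<comment> \<open>Starting at time \<open>- T\<close> leaves at least \<open>T\<close> steps to
    reach \<open>y\<close>, hence a speed of at most \<open>\<sigma>\<close>, where the price per
    unit of distance is at most \<open>g + \<eta>\<close>.\<close>
  have "\<sigma> * real T \<le> \<sigma> * real (T + s)" using T by (intro mult_left_mono) auto
  then have "real_of_int \<bar>y\<bar> \<le> \<sigma> * real (T + s)" using yR T(3) by linarith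
  then have D: "excess c (\<lambda>i. b (i - int T)) f (T + s) y \<le> (g + \<eta>) * real_of_int \<bar>y\<bar> + \<epsilon> * real (T + s)"
    using up' t0s(2) unfolding excess_below_def by blast
  have E: "excess c (\<lambda>i. b (i - int T)) f (T + T) x \<le> excess c (\<lambda>i. b (i - int T)) f (T + s) y + cost c b f \<gamma> s T"
    unfolding x_def y_def using sT ys step T(1) by (intro excess_shift_concat) (auto simp: y_def)
  have F: "cost c b f \<gamma> 0 s + cost c b f \<gamma> s T = excess c b f T x"
    using free_minimizer_prefix[OF min T(1), of c] cost_split[of 0 s T c b f \<gamma>] sT by (simp add: x_def)
  have H: "cost c b f \<gamma> 0 s = excess c b f s y"
    using free_minimizer_prefix[OF min sn, of c] by (simp add: y_def)
  have "(g + \<delta>) * real_of_int \<bar>z\<bar> = (g + \<delta>) * real_of_int \<bar>y\<bar> + (g + \<delta>) * real m"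
    by (simp add: z algebra_simps)
  then have A': "(g + \<delta>) * real_of_int \<bar>y\<bar> \<le> excess c b f s y + 2 * c * real m + \<epsilon> * real (s + m)"
    using A ext mult_nonneg_nonneg[of "g + \<delta>" "real m"] g \<delta> by linarith
  have "\<epsilon> * real s \<le> \<epsilon> * real T" using sT \<epsilon> by (intro mult_left_mono) auto
  \<comment> \<open>The four error terms have durations \<open>s + m\<close>, \<open>T\<close>,
    \<open>2 * T\<close> and \<open>T + s\<close>, together at most \<open>6 * T + m\<close>. The
    terms in \<open>g\<close> cancel.\<close>
  then have "\<delta> * real_of_int \<bar>y\<bar> \<le> \<eta> * (real_of_int \<bar>x\<bar> + real_of_int \<bar>y\<bar>) + \<epsilon> * (6 * real T + real m) + 2 * c * real m"
    using A' B C D E F H by (simp add: algebra_simps)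
  moreover have "\<eta> * (real_of_int \<bar>x\<bar> + real_of_int \<bar>y\<bar>) \<le> \<eta> * (R + R)"
    using xR yR \<eta> by (intro mult_left_mono) auto
  moreover have "\<delta> * (real_of_int \<bar>l\<bar> - 1) \<le> \<delta> * real_of_int \<bar>y\<bar>"
    using y_ge \<delta> by (intro mult_left_mono) linarith+
  ultimately show ?thesis by (simp add: algebra_simps)
qed

text \<open>Walking fewer than \<open>12 * L\<close> sites to the good edge and staying on it costs
  at most \<open>(24 * c + 2) * L\<close>, and the minimizer costs no more. Going as far as
  \<open>C * L\<close> would exceed this through new sites alone, and at least \<open>n / 12\<close>
  sign changes must be paid at the gap of \<open>l\<close>.\<close>

lemma minimizer_range_and_gap:
  assumes env: "admissible_env c b f" and n: "2 \<le> n"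
    and min: "free_minimizer b f n \<gamma>" and ell: "is_ell c f n \<gamma> l"
    and j: "j < 6 * L" and edge: "f (2 * int j) > c - 2 * real L / real n" "f (2 * int j + 1) < 2 * real L / real n - c"
    and C: "24 * c + 2 < \<eta> * real C"
    and sites: "\<eta> * real (C * L) \<le> (\<Sum>x=1..C * L. c - \<bar>f (int x)\<bar>)"
    and sites': "\<eta> * real (C * L) \<le> (\<Sum>x=1..C * L. c - \<bar>f (- int x)\<bar>)"
    and changes: "real (n div 2) / 4 \<le> (\<Sum>j<n div 2. if b (int (2*j+1)) \<noteq> b (int (2*j+2)) then 1 else 0)"
  shows "\<And>i. i \<le> n \<Longrightarrow> \<bar>\<gamma> i\<bar> \<le> int (C * L)"
    and "dgap c f l \<le> 12 * (24 * c + 2) * real L / real n"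
proof -
  have c: "0 \<le> c" using admissible_env_c_nonneg[OF env] .
  have L: "0 < real L" using j by simp
  have w: "lazy_walk n \<gamma>" using min by (simp add: free_minimizer_def)
  have edge': "f (int (2 * j)) > c - 2 * real L / real n" "f (int (2 * j) + 1) < - c + 2 * real L / real n"
    using edge by auto
  obtain \<beta> where \<beta>: "lazy_walk n \<beta>" "cost c b f \<beta> 0 n \<le> 2 * c * real (2 * j) + 2 * real L / real n * real n"
    using walk_to_edge[OF env edge', of n] by auto
  have "cost c b f \<gamma> 0 n \<le> cost c b f \<beta> 0 n" using free_minimizer_cost_le[OF min \<beta>(1)] .
  also have "\<dots> \<le> 2 * c * real (2 * j) + 2 * real L" using \<beta>(2) n by simp
  also have "2 * c * real (2 * j) \<le> 2 * c * (12 * real L)" using j c by (intro mult_left_mono) auto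
  finally have cost_ub: "cost c b f \<gamma> 0 n \<le> (24 * c + 2) * real L" by (simp add: algebra_simps)
  have lt: "(24 * c + 2) * real L < \<eta> * real (C * L)" using C L by simp
  show "\<bar>\<gamma> i\<bar> \<le> int (C * L)" if i: "i \<le> n" for i
  proof (rule ccontr)
    assume "\<not> ?thesis"
    then have "int (C * L) \<le> \<gamma> i \<or> \<gamma> i \<le> - int (C * L)" by linarith
    then have "\<eta> * real (C * L) \<le> cost c b f \<gamma> 0 n"
      using cost_ge_sites[OF env w i, of "C * L"] cost_ge_sites_neg[OF env w i, of "C * L"] sites sites' by linarith
    then show False using cost_ub lt by linarith
  qed
  have dnn: "0 \<le> dgap c f l"
  proof -
    have "\<bar>f (l + 1)\<bar> \<le> c" "\<bar>f l\<bar> \<le> c" using env by (auto simp: admissible_env_def)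
    then show ?thesis unfolding dgap_def by linarith
  qed
  have "n \<le> 3 * (n div 2)" using n by presburger
  then have "real n / 3 \<le> real (n div 2)" by linarith
  then have "dgap c f l * (real n / 12) \<le> dgap c f l * (real (n div 2) / 4)" using dnn by (intro mult_left_mono) auto
  also have "\<dots> \<le> dgap c f l * (\<Sum>j<n div 2. if b (int (2*j+1)) \<noteq> b (int (2*j+2)) then 1 else 0)"
    using changes dnn by (rule mult_left_mono)
  also have "\<dots> \<le> cost c b f \<gamma> 0 n" by (rule cost_ge_changes[OF env w ell])
  finally have "dgap c f l * (real n / 12) \<le> (24 * c + 2) * real L" using cost_ub by linarith
  then show "dgap c f l \<le> 12 * (24 * c + 2) * real L / real n" using n by (simp add: field_simps)
qed

subsection \<open>The random environment\<close>

context prob_space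
begin

lemma prob_Int_ge:
  assumes "A \<in> events" "A' \<in> events" shows "prob A + prob A' - 1 \<le> prob (A \<inter> A')"
proof -
  have "prob (A \<union> A') = prob A + prob A' - prob (A \<inter> A')"
    using assms by (simp add: finite_measure_Union' finite_measure_Diff' Int_commute)
  then show ?thesis using prob_le_1[of "A \<union> A'"] by linarith
qed

lemma AE_positive_prob_exists:
  assumes "AE \<omega> in M. P \<omega>" "A \<in> events" "0 < prob A"
  shows "\<exists>\<omega>\<in>A. P \<omega>"
proof (rule ccontr)
  assume "\<not> ?thesis"
  then have "AE \<omega> in M. \<omega> \<notin> A" using assms(1) by (auto elim: eventually_mono)
  then have "prob A = 0" using assms(2) by (simp add: prob_eq_0)
  then show False using assms(3) by simp
qed

lemma prob_tendsto_1_if_AE_eventually: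
  assumes [measurable]: "\<And>n::nat. A n \<in> events" and ae: "AE \<omega> in M. eventually (\<lambda>n. \<omega> \<in> A n) sequentially"
  shows "(\<lambda>n. prob (A n)) \<longlonglongrightarrow> 1"
proof -
  have "(\<lambda>n. \<integral>\<omega>. indicator (A n) \<omega> \<partial>M) \<longlonglongrightarrow> (\<integral>\<omega>. (1::real) \<partial>M)"
  proof (rule integral_dominated_convergence[where w = "\<lambda>_. 1"])
    show "AE \<omega> in M. (\<lambda>n. indicator (A n) \<omega>) \<longlonglongrightarrow> (1::real)"
      using ae
    proof eventually_elim
      case (elim \<omega>)
      then show ?case by (intro tendsto_eventually) (auto elim: eventually_mono)
    qed
  qed (auto simp: indicator_def)
  then show ?thesis by (simp add: prob_space)
qed

lemma prob_tendsto_1_Int: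
  assumes [measurable]: "\<And>n::nat. A n \<in> events" "\<And>n. B n \<in> events"
    and A: "(\<lambda>n. prob (A n)) \<longlonglongrightarrow> 1" and B: "(\<lambda>n. prob (B n)) \<longlonglongrightarrow> 1"
  shows "(\<lambda>n. prob (A n \<inter> B n)) \<longlonglongrightarrow> 1"
proof (rule tendsto_sandwich[OF _ _ _ tendsto_const])
  show "eventually (\<lambda>n. prob (A n) + prob (B n) - 1 \<le> prob (A n \<inter> B n)) sequentially"
    by (intro always_eventually allI prob_Int_ge assms)
  show "(\<lambda>n. prob (A n) + prob (B n) - 1) \<longlonglongrightarrow> 1"
    using tendsto_diff[OF tendsto_add[OF A B] tendsto_const[of 1]] by simp
qed (auto intro: prob_le_1)

text \<open>Hoeffding's inequality with deviation \<open>\<mu> / 2 * m\<close>: falling below half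
  the mean has exponentially small probability.\<close>

lemma prob_sum_ge_half_mean:
  fixes Y :: "nat \<Rightarrow> 'a \<Rightarrow> real"
  assumes ind: "indep_vars (\<lambda>_. borel) Y UNIV" and bd: "\<And>j. AE \<omega> in M. Y j \<omega> \<in> {0..b}"
    and mean: "\<And>j. expectation (Y j) = \<mu>" and \<mu>: "\<mu> > 0" and b: "b > 0"
  shows "(\<lambda>m. prob {\<omega> \<in> space M. \<mu> / 2 * real m \<le> (\<Sum>j<m. Y j \<omega>)}) \<longlonglongrightarrow> 1"
proof -
  have [measurable]: "Y j \<in> borel_measurable M" for j using ind by (auto simp: indep_vars_def)
  have bound: "1 - exp (- (\<mu>\<^sup>2 / (2 * b\<^sup>2)) * real m) \<le> prob {\<omega> \<in> space M. \<mu> / 2 * real m \<le> (\<Sum>j<m. Y j \<omega>)}"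
    if m: "m > 0" for m
  proof -
    interpret H: Hoeffding_ineq M "{..<m}" Y "\<lambda>_. 0" "\<lambda>_. b" "\<Sum>j<m. expectation (Y j)"
      using indep_vars_subset[OF ind] bd by unfold_locales auto
    have "prob {\<omega>\<in>space M. (\<Sum>j<m. Y j \<omega>) \<le> (\<Sum>j<m. expectation (Y j)) - \<mu> / 2 * real m}
      \<le> exp (-2 * (\<mu> / 2 * real m)\<^sup>2 / (\<Sum>i<m. (b - 0)\<^sup>2))"
      using \<mu> b m by (intro H.Hoeffding_ineq_le) auto
    also have "(\<Sum>j<m. expectation (Y j)) - \<mu> / 2 * real m = \<mu> / 2 * real m" by (simp add: mean)
    also have "-2 * (\<mu> / 2 * real m)\<^sup>2 / (\<Sum>i<m. (b - 0)\<^sup>2) = - (\<mu>\<^sup>2 / (2 * b\<^sup>2)) * real m"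
      using b m by (simp add: field_simps power2_eq_square)
    finally have le: "prob {\<omega>\<in>space M. (\<Sum>j<m. Y j \<omega>) \<le> \<mu> / 2 * real m} \<le> exp (- (\<mu>\<^sup>2 / (2 * b\<^sup>2)) * real m)" .
    have "1 - prob {\<omega> \<in> space M. \<mu> / 2 * real m \<le> (\<Sum>j<m. Y j \<omega>)}
       = prob (space M - {\<omega> \<in> space M. \<mu> / 2 * real m \<le> (\<Sum>j<m. Y j \<omega>)})"
      by (subst prob_compl) auto
    also have "\<dots> \<le> prob {\<omega>\<in>space M. (\<Sum>j<m. Y j \<omega>) \<le> \<mu> / 2 * real m}"
      by (intro finite_measure_mono) auto
    finally show ?thesis using le by linarith
  qed
  have "(\<lambda>m. exp (- (\<mu>\<^sup>2 / (2 * b\<^sup>2)) * real m)) \<longlonglongrightarrow> 0"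
  proof (rule filterlim_compose[OF exp_at_bot])
    have "LIM m sequentially. (\<mu>\<^sup>2 / (2 * b\<^sup>2)) * real m :> at_top"
      using \<mu> b by (intro filterlim_tendsto_pos_mult_at_top[OF tendsto_const] filterlim_real_sequentially) auto
    then show "LIM m sequentially. - (\<mu>\<^sup>2 / (2 * b\<^sup>2)) * real m :> at_bot"
      by (simp add: filterlim_uminus_at_top)
  qed
  then have "(\<lambda>m. 1 - exp (- (\<mu>\<^sup>2 / (2 * b\<^sup>2)) * real m)) \<longlonglongrightarrow> 1"
    using tendsto_diff[OF tendsto_const[of 1]] by fastforce
  moreover have "eventually (\<lambda>m. 1 - exp (- (\<mu>\<^sup>2 / (2 * b\<^sup>2)) * real m)
      \<le> prob {\<omega> \<in> space M. \<mu> / 2 * real m \<le> (\<Sum>j<m. Y j \<omega>)}) sequentially"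
    using eventually_gt_at_top[of 0] by eventually_elim (rule bound)
  ultimately show ?thesis
    by (intro tendsto_sandwich[OF _ _ _ tendsto_const, of _ "\<lambda>m. prob {\<omega> \<in> space M. \<mu> / 2 * real m \<le> (\<Sum>j<m. Y j \<omega>)}"])
       auto
qed

text \<open>The blocks \<open>{p j, r j}\<close> are disjoint for different \<open>j\<close>. The
  two indices of one block may coincide, which covers functions of a single variable.\<close>

lemma indep_vars_pairs:
  fixes X :: "'i \<Rightarrow> 'a \<Rightarrow> real"
  assumes ind: "indep_vars (\<lambda>_. borel) X UNIV"
    and disj: "disjoint_family_on (\<lambda>j. {p j, r j}) UNIV"
    and \<phi>[measurable]: "\<phi> \<in> borel_measurable (borel \<Otimes>\<^sub>M borel)"
  shows "indep_vars (\<lambda>_. borel) (\<lambda>(j::nat) \<omega>. \<phi> (X (p j) \<omega>, X (r j) \<omega>) :: real) UNIV"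
proof -
  have "indep_vars (\<lambda>j. PiM {p j, r j} (\<lambda>_. borel)) (\<lambda>j \<omega>. restrict (\<lambda>i. X i \<omega>) {p j, r j}) UNIV"
    by (rule indep_vars_restrict[OF ind _ disj]) auto
  then have "indep_vars (\<lambda>_. borel) (\<lambda>j \<omega>. (\<lambda>u. \<phi> (u (p j), u (r j))) (restrict (\<lambda>i. X i \<omega>) {p j, r j})) UNIV"
    by (rule indep_vars_compose2) measurable
  then show ?thesis by simp
qed

end

lemma disjoint_family_on_pairs:
  assumes "inj h"
  shows "disjoint_family_on (\<lambda>j::nat. {h (2 * int j + i), h (2 * int j + i + 1)}) UNIV"
  unfolding disjoint_family_on_def
proof (intro ballI impI)
  fix j k :: nat assume jk: "j \<noteq> k"
  have "2 * int j + i \<noteq> 2 * int k + i + 1" "2 * int j + i + 1 \<noteq> 2 * int k + i" by presburger+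
  then show "{h (2 * int j + i), h (2 * int j + i + 1)} \<inter> {h (2 * int k + i), h (2 * int k + i + 1)} = {}"
    using jk inj_eq[OF assms] by auto
qed

section \<open>The environment as a random element of a product space\<close>

abbreviation env_space :: "(int + int \<Rightarrow> real) measure" where
  "env_space \<equiv> PiM UNIV (\<lambda>_. borel)"

text \<open>Such a predicate is decided by the law of the whole environment, with sites under
  \<open>Inl\<close> and times under \<open>Inr\<close>, so its probability is unchanged by
  relabellings that preserve this law.\<close>

definition measurable_env_pred :: "((int \<Rightarrow> real) \<Rightarrow> (int \<Rightarrow> real) \<Rightarrow> bool) \<Rightarrow> bool" where
  "measurable_env_pred P \<longleftrightarrow> Measurable.pred env_space (\<lambda>u. P (\<lambda>i. u (Inr i)) (\<lambda>x. u (Inl x)))"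

lemma borel_measurable_Min_image:
  fixes f :: "'i \<Rightarrow> 'a \<Rightarrow> real"
  assumes "finite I" "\<And>i. i \<in> I \<Longrightarrow> f i \<in> borel_measurable N"
  shows "(\<lambda>u. Min ((\<lambda>i. f i u) ` I)) \<in> borel_measurable N"
  using assms
proof (induction I rule: finite_induct)
  case (insert i I)
  show ?case
  proof (cases "I = {}")
    case False
    then have "(\<lambda>u. Min ((\<lambda>i. f i u) ` insert i I)) = (\<lambda>u. min (f i u) (Min ((\<lambda>i. f i u) ` I)))"
      using insert by auto
    then show ?thesis using insert by auto
  qed (use insert in auto)
qed auto

lemma measurable_excess [measurable]:
  "(\<lambda>u. excess c (\<lambda>i. u (Inr i)) (\<lambda>x. u (Inl x)) t x) \<in> borel_measurable env_space"
proof -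
  have "(\<lambda>u. min_action (\<lambda>i. u (Inr i)) (\<lambda>x. u (Inl x)) t x) \<in> borel_measurable env_space"
    unfolding min_action_eq_Min_walks
    by (rule borel_measurable_Min_image[OF finite_walks]) (simp add: action_def)
  then show ?thesis unfolding excess_def by simp
qed

lemma measurable_shape_limit: "measurable_env_pred (\<lambda>b f. shape_limit c b f G \<alpha>)"
  unfolding measurable_env_pred_def shape_limit_def by measurable

lemma measurable_excess_above: "measurable_env_pred (\<lambda>b f. excess_above c b f \<sigma> m \<epsilon> t0)"
  unfolding measurable_env_pred_def excess_above_def by measurable

lemma measurable_excess_below: "measurable_env_pred (\<lambda>b f. excess_below c b f \<sigma> m \<epsilon> t0)"
  unfolding measurable_env_pred_def excess_below_def by measurable

locale random_env = prob_space M for M :: "'w measure" +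
  fixes F B :: "'w \<Rightarrow> int \<Rightarrow> real" and \<rho> :: "real \<Rightarrow> real" and c q \<kappa> :: real
  assumes c_pos: "c > 0" and q_pos: "q > 0"
    and indep: "indep_vars (\<lambda>_. borel)
                  (\<lambda>j \<omega>. case j of Inl x \<Rightarrow> F \<omega> x | Inr i \<Rightarrow> B \<omega> i) (UNIV :: (int + int) set)"
    and F_dens: "\<And>x. distributed M lborel (\<lambda>\<omega>. F \<omega> x) (\<lambda>y. ennreal (\<rho> y))"
    and B_plus: "\<And>i. prob {\<omega> \<in> space M. B \<omega> i = 1} = 1/2"
    and B_minus: "\<And>i. prob {\<omega> \<in> space M. B \<omega> i = -1} = 1/2"
    and rho_even: "\<And>y. \<rho> (- y) = \<rho> y"
    and rho_pos: "\<And>y. -c < y \<Longrightarrow> y < c \<Longrightarrow> \<rho> y > 0"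
    and rho_zero: "\<And>y. \<bar>y\<bar> \<ge> c \<Longrightarrow> \<rho> y = 0"
    and rho_edge: "((\<lambda>y. \<rho> y / \<bar>c - y\<bar> powr \<kappa>) \<longlongrightarrow> q) (at_left c)"
begin

definition env_var :: "int + int \<Rightarrow> 'w \<Rightarrow> real" where
  "env_var j \<omega> = (case j of Inl x \<Rightarrow> F \<omega> x | Inr i \<Rightarrow> B \<omega> i)"

lemma env_var_simps [simp]: "env_var (Inl x) = (\<lambda>\<omega>. F \<omega> x)" "env_var (Inr i) = (\<lambda>\<omega>. B \<omega> i)"
  by (auto simp: env_var_def)

lemma indep_env: "indep_vars (\<lambda>_. borel) env_var UNIV"
  using indep unfolding env_var_def .

lemma env_var_measurable [measurable]: "env_var j \<in> borel_measurable M"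
  using indep_env by (auto simp: indep_vars_def)

lemma F_measurable [measurable]: "(\<lambda>\<omega>. F \<omega> x) \<in> borel_measurable M"
  using env_var_measurable[of "Inl x"] by simp

lemma B_measurable [measurable]: "(\<lambda>\<omega>. B \<omega> i) \<in> borel_measurable M"
  using env_var_measurable[of "Inr i"] by simp

lemma rho_measurable [measurable]: "(\<lambda>y. ennreal (\<rho> y)) \<in> borel_measurable borel"
  using distributed_borel_measurable[OF F_dens[of 0]] by simp

lemma AE_B_values: "AE \<omega> in M. B \<omega> i = 1 \<or> B \<omega> i = -1"
proof -
  have "prob ({\<omega> \<in> space M. B \<omega> i = 1} \<union> {\<omega> \<in> space M. B \<omega> i = -1}) = 1"
    by (subst finite_measure_Union) (auto simp: B_plus B_minus)
  then have "AE \<omega> in M. \<omega> \<in> {\<omega> \<in> space M. B \<omega> i = 1} \<union> {\<omega> \<in> space M. B \<omega> i = -1}"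
    by (subst (asm) prob_eq_1) auto
  then show ?thesis by eventually_elim auto
qed

lemma AE_F_bounded: "AE \<omega> in M. \<bar>F \<omega> x\<bar> < c"
proof -
  have "emeasure M ((\<lambda>\<omega>. F \<omega> x) -` {y. c \<le> \<bar>y\<bar>} \<inter> space M) = (\<integral>\<^sup>+y. ennreal (\<rho> y) * indicator {y. c \<le> \<bar>y\<bar>} y \<partial>lborel)"
    by (rule distributed_emeasure[OF F_dens]) auto
  also have "\<dots> = (\<integral>\<^sup>+(y::real). 0 \<partial>lborel)"
    by (intro nn_integral_cong) (auto simp: rho_zero indicator_def)
  finally have "emeasure M ((\<lambda>\<omega>. F \<omega> x) -` {y. c \<le> \<bar>y\<bar>} \<inter> space M) = 0" by simp
  then show ?thesis
    by (intro AE_I[where N = "(\<lambda>\<omega>. F \<omega> x) -` {y. c \<le> \<bar>y\<bar>} \<inter> space M"]) auto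
qed

lemma AE_admissible_env: "AE \<omega> in M. admissible_env c (B \<omega>) (F \<omega>)"
proof -
  have "AE \<omega> in M. \<forall>i. B \<omega> i = 1 \<or> B \<omega> i = -1" using AE_B_values by (simp add: AE_all_countable)
  moreover have "AE \<omega> in M. \<forall>x. \<bar>F \<omega> x\<bar> < c" using AE_F_bounded by (simp add: AE_all_countable)
  ultimately show ?thesis by eventually_elim (auto simp: admissible_env_def less_imp_le)
qed

lemma prob_B_in:
  assumes [measurable]: "A \<in> sets borel"
  shows "prob {\<omega> \<in> space M. B \<omega> i \<in> A} = (if 1 \<in> A then 1/2 else 0) + (if -1 \<in> A then 1/2 else 0)"
proof -
  have "prob {\<omega> \<in> space M. B \<omega> i \<in> A} =
    prob ({\<omega> \<in> space M. B \<omega> i = 1 \<and> 1 \<in> A} \<union> {\<omega> \<in> space M. B \<omega> i = -1 \<and> -1 \<in> A})"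
    using AE_B_values[of i] by (intro finite_measure_eq_AE) auto
  also have "\<dots> = prob {\<omega> \<in> space M. B \<omega> i = 1 \<and> 1 \<in> A} + prob {\<omega> \<in> space M. B \<omega> i = -1 \<and> -1 \<in> A}"
    by (intro finite_measure_Union) auto
  finally show ?thesis by (simp add: B_plus B_minus)
qed

lemma distr_B_eq: "distr M borel (\<lambda>\<omega>. B \<omega> i) = distr M borel (\<lambda>\<omega>. B \<omega> j)"
proof (rule measure_eqI)
  fix A assume "A \<in> sets (distr M borel (\<lambda>\<omega>. B \<omega> i))"
  then have A[measurable]: "A \<in> sets borel" by simp
  have *: "(\<lambda>\<omega>. B \<omega> i) -` A \<inter> space M = {\<omega> \<in> space M. B \<omega> i \<in> A}" for i by auto
  show "emeasure (distr M borel (\<lambda>\<omega>. B \<omega> i)) A = emeasure (distr M borel (\<lambda>\<omega>. B \<omega> j)) A"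
    by (simp add: emeasure_distr * emeasure_eq_measure prob_B_in)
qed simp

lemma distr_F_eq: "distr M borel (\<lambda>\<omega>. F \<omega> x) = distr M borel (\<lambda>\<omega>. F \<omega> y)"
proof -
  have "distr M borel (\<lambda>\<omega>. F \<omega> x) = density lborel (\<lambda>y. ennreal (\<rho> y))" for x
    using distributed_distr_eq_density[OF F_dens[of x]] by (simp cong: distr_cong)
  then show ?thesis by metis
qed

text \<open>By independence both laws are products of their marginals, and an injective relabelling
  keeps the family independent.\<close>

lemma law_invariant:
  assumes inj: "inj \<pi>" and law: "\<And>j. distr M borel (env_var (\<pi> j)) = distr M borel (env_var j)"
  shows "distr M env_space (\<lambda>\<omega> j. env_var (\<pi> j) \<omega>) = distr M env_space (\<lambda>\<omega> j. env_var j \<omega>)"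
proof -
  have "indep_vars (\<lambda>j. PiM {\<pi> j} (\<lambda>_. borel)) (\<lambda>j \<omega>. restrict (\<lambda>i. env_var i \<omega>) {\<pi> j}) UNIV"
    using inj by (intro indep_vars_restrict[OF indep_env]) (auto simp: disjoint_family_on_def inj_def)
  then have "indep_vars (\<lambda>_. borel) (\<lambda>j \<omega>. (\<lambda>u. u (\<pi> j)) (restrict (\<lambda>i. env_var i \<omega>) {\<pi> j})) UNIV"
    by (rule indep_vars_compose2) measurable
  then have ind: "indep_vars (\<lambda>_. borel) (\<lambda>j. env_var (\<pi> j)) UNIV" by (simp add: eta_contract_eq)
  have "distr M env_space (\<lambda>\<omega>. \<lambda>j\<in>UNIV. env_var (\<pi> j) \<omega>) = PiM UNIV (\<lambda>j. distr M borel (env_var (\<pi> j)))"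
    using ind by (subst (asm) indep_vars_iff_distr_eq_PiM) auto
  also have "\<dots> = PiM UNIV (\<lambda>j. distr M borel (env_var j))" by (simp add: law)
  also have "\<dots> = distr M env_space (\<lambda>\<omega>. \<lambda>j\<in>UNIV. env_var j \<omega>)"
    using indep_env by (subst (asm) indep_vars_iff_distr_eq_PiM) auto
  finally show ?thesis by (simp add: restrict_def)
qed

lemma env_measurable [measurable]: "(\<lambda>\<omega> j. env_var (\<pi> j) \<omega>) \<in> measurable M env_space"
  by (rule measurable_PiM_single') auto

lemma env_pred_sets:
  assumes "measurable_env_pred P" shows "{\<omega> \<in> space M. P (B \<omega>) (F \<omega>)} \<in> events"
proof -
  have [measurable]: "Measurable.pred env_space (\<lambda>u. P (\<lambda>i. u (Inr i)) (\<lambda>x. u (Inl x)))"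
    using assms by (simp add: measurable_env_pred_def)
  have "{\<omega> \<in> space M. (\<lambda>u. P (\<lambda>i. u (Inr i)) (\<lambda>x. u (Inl x))) (\<lambda>j. env_var (id j) \<omega>)} \<in> events"
    by measurable
  then show ?thesis by simp
qed

text \<open>Sites are relabelled by \<open>r\<close> and times by \<open>s\<close> without mixing
  the two kinds, so the marginals agree. It is used for time shifts and for the reflection of
  space.\<close>

lemma env_pred_invariant:
  assumes P: "measurable_env_pred P" and s: "inj s" and r: "inj r"
  shows "{\<omega> \<in> space M. P (\<lambda>i. B \<omega> (s i)) (\<lambda>x. F \<omega> (r x))} \<in> events" (is ?A)
    and "prob {\<omega> \<in> space M. P (\<lambda>i. B \<omega> (s i)) (\<lambda>x. F \<omega> (r x))} = prob {\<omega> \<in> space M. P (B \<omega>) (F \<omega>)}" (is ?B)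
proof -
  define Q where "Q = (\<lambda>u :: int + int \<Rightarrow> real. P (\<lambda>i. u (Inr i)) (\<lambda>x. u (Inl x)))"
  have [measurable]: "Measurable.pred env_space Q"
    using P by (simp add: measurable_env_pred_def Q_def)
  define \<pi> where "\<pi> = map_sum r s"
  have "inj \<pi>" unfolding \<pi>_def using s r by (intro sum.inj_map)
  moreover have "distr M borel (env_var (\<pi> j)) = distr M borel (env_var j)" for j
  proof (cases j)
    case (Inl x) then show ?thesis using distr_F_eq[of "r x" x] by (simp add: \<pi>_def)
  next
    case (Inr i) then show ?thesis using distr_B_eq[of "s i" i] by (simp add: \<pi>_def)
  qed
  ultimately have D: "distr M env_space (\<lambda>\<omega> j. env_var (\<pi> j) \<omega>) = distr M env_space (\<lambda>\<omega> j. env_var j \<omega>)"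
    by (rule law_invariant)
  have 1: "{\<omega> \<in> space M. P (\<lambda>i. B \<omega> (s i)) (\<lambda>x. F \<omega> (r x))} = (\<lambda>\<omega> j. env_var (\<pi> j) \<omega>) -` {u\<in>space env_space. Q u} \<inter> space M"
    by (auto simp: Q_def \<pi>_def space_PiM)
  have 2: "{\<omega> \<in> space M. P (B \<omega>) (F \<omega>)} = (\<lambda>\<omega> j. env_var j \<omega>) -` {u\<in>space env_space. Q u} \<inter> space M"
    by (auto simp: Q_def space_PiM)
  have m: "(\<lambda>\<omega> j. env_var j \<omega>) \<in> measurable M env_space" using env_measurable[of id] by simp
  show ?A unfolding 1 by measurable
  have S: "{u\<in>space env_space. Q u} \<in> sets env_space" by measurable
  show ?B unfolding 1 2
    using measure_distr[OF env_measurable S, of \<pi>] measure_distr[OF m S] by (simp add: D)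
qed

lemma AE_env_pred_invariant:
  assumes P: "measurable_env_pred P" and s: "inj s" and r: "inj r" and ae: "AE \<omega> in M. P (B \<omega>) (F \<omega>)"
  shows "AE \<omega> in M. P (\<lambda>i. B \<omega> (s i)) (\<lambda>x. F \<omega> (r x))"
proof -
  have "prob {\<omega> \<in> space M. P (B \<omega>) (F \<omega>)} = 1"
    using ae env_pred_sets[OF P] by (simp add: prob_Collect_eq_1)
  then have "prob {\<omega> \<in> space M. P (\<lambda>i. B \<omega> (s i)) (\<lambda>x. F \<omega> (r x))} = 1"
    using env_pred_invariant(2)[OF P s r] by simp
  then show ?thesis
    using env_pred_invariant(1)[OF P s r] by (simp add: prob_Collect_eq_1)
qed

text \<open>The random threshold is eventually exceeded by any deterministic \<open>k n\<close> that
  grows to infinity.\<close>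

lemma prob_env_pred_tendsto_1:
  fixes P :: "(int \<Rightarrow> real) \<Rightarrow> (int \<Rightarrow> real) \<Rightarrow> nat \<Rightarrow> bool"
  assumes P: "\<And>t. measurable_env_pred (\<lambda>b f. P b f t)"
    and mono: "\<And>b f t t'. P b f t \<Longrightarrow> t \<le> t' \<Longrightarrow> P b f t'"
    and ae: "AE \<omega> in M. \<exists>t. P (B \<omega>) (F \<omega>) t" and k: "filterlim k at_top sequentially"
  shows "(\<lambda>n. prob {\<omega> \<in> space M. P (B \<omega>) (F \<omega>) (k n)}) \<longlonglongrightarrow> 1"
proof (rule prob_tendsto_1_if_AE_eventually)
  show "{\<omega> \<in> space M. P (B \<omega>) (F \<omega>) (k n)} \<in> events" for n by (rule env_pred_sets[OF P])
  show "AE \<omega> in M. eventually (\<lambda>n. \<omega> \<in> {\<omega> \<in> space M. P (B \<omega>) (F \<omega>) (k n)}) sequentially"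
    using ae AE_space
  proof eventually_elim
    case (elim \<omega>)
    then obtain t where t: "P (B \<omega>) (F \<omega>) t" by blast
    have "eventually (\<lambda>n. t \<le> k n) sequentially" using k by (simp add: filterlim_at_top)
    then show ?case by eventually_elim (use t mono elim in auto)
  qed
qed

lemma inj_time_shift: "inj (\<lambda>i::int. i - T)" "inj (\<lambda>i::int. i + T)" by (auto simp: inj_def)

lemma prob_shift:
  assumes "measurable_env_pred P"
  shows "{\<omega> \<in> space M. P (\<lambda>i. B \<omega> (i - T)) (F \<omega>)} \<in> events"
    "prob {\<omega> \<in> space M. P (\<lambda>i. B \<omega> (i - T)) (F \<omega>)} = prob {\<omega> \<in> space M. P (B \<omega>) (F \<omega>)}"
    "{\<omega> \<in> space M. P (\<lambda>i. B \<omega> (i + T)) (F \<omega>)} \<in> events"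
    "prob {\<omega> \<in> space M. P (\<lambda>i. B \<omega> (i + T)) (F \<omega>)} = prob {\<omega> \<in> space M. P (B \<omega>) (F \<omega>)}"
  using env_pred_invariant[OF assms inj_time_shift(1)[of T] inj_on_id]
    env_pred_invariant[OF assms inj_time_shift(2)[of T] inj_on_id] by simp_all

end

subsection \<open>Gaps and the localization scale\<close>

context random_env
begin

section \<open>The tail of the site variables near the edge of their support\<close>

definition tail :: "real \<Rightarrow> real" where
  "tail e = prob {\<omega> \<in> space M. F \<omega> 0 > c - e}"

lemma tail_nonneg: "0 \<le> tail e" and tail_le_1: "tail e \<le> 1"
  by (simp_all add: tail_def)

lemma prob_F_in:
  assumes [measurable]: "A \<in> sets borel"
  shows "ennreal (prob {\<omega> \<in> space M. F \<omega> x \<in> A}) = (\<integral>\<^sup>+y. ennreal (\<rho> y) * indicator A y \<partial>lborel)"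
proof -
  have "{\<omega> \<in> space M. F \<omega> x \<in> A} = (\<lambda>\<omega>. F \<omega> x) -` A \<inter> space M" by auto
  then show ?thesis
    using distributed_emeasure[OF F_dens[of x], of A] by (simp add: emeasure_eq_measure)
qed

lemma prob_F_in_eq:
  assumes "A \<in> sets borel"
  shows "prob {\<omega> \<in> space M. F \<omega> x \<in> A} = prob {\<omega> \<in> space M. F \<omega> y \<in> A}"
proof -
  have "ennreal (prob {\<omega> \<in> space M. F \<omega> x \<in> A}) = ennreal (prob {\<omega> \<in> space M. F \<omega> y \<in> A})"
    by (simp only: prob_F_in[OF assms])
  then show ?thesis by (simp add: ennreal_inj)
qed

lemma tail_eq: "prob {\<omega> \<in> space M. F \<omega> x > c - e} = tail e"
  using prob_F_in_eq[of "{c - e<..}" x 0] by (simp add: tail_def)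

lemma tail_eq_neg: "prob {\<omega> \<in> space M. F \<omega> x < e - c} = tail e"
proof -
  have "ennreal (prob {\<omega> \<in> space M. F \<omega> x \<in> {..< e - c}}) =
      (\<integral>\<^sup>+y. ennreal (\<rho> y) * indicator {..< e - c} y \<partial>lborel)"
    by (rule prob_F_in) simp
  also have "\<dots> = (\<integral>\<^sup>+y. ennreal (\<rho> (0 + (-1) * y)) * indicator {..< e - c} (0 + (-1) * y) \<partial>lborel)"
    by (subst nn_integral_real_affine[where c = "-1" and t = 0]) simp_all
  also have "\<dots> = (\<integral>\<^sup>+y. ennreal (\<rho> y) * indicator {c - e<..} y \<partial>lborel)"
    by (intro nn_integral_cong) (auto simp: rho_even indicator_def)
  also have "\<dots> = ennreal (prob {\<omega> \<in> space M. F \<omega> x \<in> {c - e<..}})"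
    by (rule prob_F_in[symmetric]) simp
  finally show ?thesis by (simp add: tail_eq ennreal_inj tail_nonneg)
qed

lemma tail_mono: "e \<le> e' \<Longrightarrow> tail e \<le> tail e'"
  unfolding tail_def by (intro finite_measure_mono) auto

lemma tail_pos:
  assumes e: "0 < e" shows "0 < tail e"
proof (rule ccontr)
  assume "\<not> 0 < tail e"
  then have "tail e = 0" using tail_nonneg[of e] by simp
  then have "(\<integral>\<^sup>+y. ennreal (\<rho> y) * indicator {c - e<..} y \<partial>lborel) = 0"
    using prob_F_in[of "{c - e<..}" 0] by (simp add: tail_def)
  then have ae: "AE y in lborel. ennreal (\<rho> y) * indicator {c - e<..} y = 0"
    by (subst (asm) nn_integral_0_iff_AE) auto
  define a where "a = max (- c) (c - e)"
  have "a < c" using c_pos e by (simp add: a_def)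
  have "AE y in lborel. y \<notin> {a<..<c}"
    using ae
  proof eventually_elim
    case (elim y)
    then show ?case using rho_pos[of y] by (auto simp: a_def indicator_def)
  qed
  then have "emeasure lborel {a<..<c} = 0"
    by (subst (asm) AE_iff_measurable[where N = "{a<..<c}"]) auto
  then show False using \<open>a < c\<close> by simp
qed

lemma tail_small:
  assumes "0 < \<delta>" shows "\<exists>e>0. tail e < \<delta>"
proof -
  define A where "A k = {\<omega> \<in> space M. F \<omega> 0 > c - 1 / real (Suc k)}" for k
  have "(\<lambda>k. prob (A k)) \<longlonglongrightarrow> prob (\<Inter>k. A k)"
  proof (rule finite_Lim_measure_decseq)
    show "decseq A" unfolding decseq_Suc_iff A_def
    proof (intro allI subsetI)
      fix n \<omega> assume "\<omega> \<in> {\<omega> \<in> space M. F \<omega> 0 > c - 1 / real (Suc (Suc n))}"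
      moreover have "1 / real (Suc (Suc n)) \<le> 1 / real (Suc n)" by (intro divide_left_mono) auto
      ultimately show "\<omega> \<in> {\<omega> \<in> space M. F \<omega> 0 > c - 1 / real (Suc n)}" by auto
    qed
  qed (auto simp: A_def)
  also have "prob (\<Inter>k. A k) = 0"
  proof -
    have "prob (\<Inter>k. A k) = prob {}"
    proof (rule finite_measure_eq_AE)
      show "AE \<omega> in M. \<omega> \<in> (\<Inter>k. A k) \<longleftrightarrow> \<omega> \<in> {}"
        using AE_F_bounded[of 0]
      proof eventually_elim
        case (elim \<omega>)
        then have "0 < c - F \<omega> 0" by auto
        then obtain k where "1 / real (Suc k) < c - F \<omega> 0"
          using reals_Archimedean by (metis inverse_eq_divide)
        then have "\<omega> \<notin> A k" by (auto simp: A_def)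
        then show ?case by auto
      qed
    qed (auto simp: A_def)
    then show ?thesis by simp
  qed
  finally have "eventually (\<lambda>k. prob (A k) < \<delta>) sequentially"
    using assms by (rule order_tendstoD(2))
  then obtain k where "prob (A k) < \<delta>" by (auto simp: eventually_sequentially)
  then show ?thesis
    by (intro exI[of _ "1 / real (Suc k)"]) (auto simp: A_def tail_def)
qed

text \<open>Near the edge \<open>\<rho>\<close> lies between \<open>q / 2\<close> and
  \<open>2 * q\<close> times the power \<open>\<kappa>\<close> of the distance to \<open>c\<close>,
  so doubling this distance changes the density by a bounded factor.\<close>

lemma tail_doubling: "\<exists>D e0. 0 < D \<and> 0 < e0 \<and> (\<forall>e. 0 < e \<and> e \<le> e0 \<longrightarrow> tail (2 * e) \<le> D * tail e)"
proof -
  have "eventually (\<lambda>y. \<rho> y / \<bar>c - y\<bar> powr \<kappa> < 2 * q) (at_left c)"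
    using rho_edge by (rule order_tendstoD(2)) (use q_pos in simp)
  moreover have "eventually (\<lambda>y. q / 2 < \<rho> y / \<bar>c - y\<bar> powr \<kappa>) (at_left c)"
    using rho_edge by (rule order_tendstoD(1)) (use q_pos in simp)
  ultimately have "eventually (\<lambda>y. \<rho> y / \<bar>c - y\<bar> powr \<kappa> < 2 * q \<and> q / 2 < \<rho> y / \<bar>c - y\<bar> powr \<kappa>) (at_left c)"
    by (rule eventually_conj)
  then obtain b where b: "b < c" and "\<And>y. b < y \<Longrightarrow> y < c \<Longrightarrow> \<rho> y / \<bar>c - y\<bar> powr \<kappa> < 2 * q \<and> q / 2 < \<rho> y / \<bar>c - y\<bar> powr \<kappa>"
    unfolding eventually_at_left_field by blast
  then have bd: "\<rho> y < 2 * q * (c - y) powr \<kappa>" "q / 2 * (c - y) powr \<kappa> < \<rho> y" if "b < y" "y < c" for y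
    using that by (auto simp: field_simps)
  \<comment> \<open>The factor 4 is the ratio of \<open>2 * q\<close> to \<open>q / 2\<close>, and
    \<open>2 powr \<kappa>\<close> comes from doubling the distance.\<close>
  define D' where "D' = 4 * 2 powr \<kappa>"
  define e0 where "e0 = (c - b) / 2"
  have D': "0 < D'" by (simp add: D'_def)
  have cmp: "\<rho> (2 * y - c) \<le> D' * \<rho> y" if y: "c - e0 < y" "y < c" for y
  proof -
    have y': "b < 2 * y - c" "2 * y - c < c" "b < y" using y b by (auto simp: e0_def field_simps)
    have "\<rho> (2 * y - c) < 2 * q * (c - (2 * y - c)) powr \<kappa>" by (rule bd(1)) fact+
    also have "c - (2 * y - c) = 2 * (c - y)" by simp
    also have "(2 * (c - y)) powr \<kappa> = 2 powr \<kappa> * (c - y) powr \<kappa>"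
      by (rule powr_mult)
    also have "2 * q * (2 powr \<kappa> * (c - y) powr \<kappa>) = D' * (q / 2 * (c - y) powr \<kappa>)" by (simp add: D'_def)
    also have "\<dots> \<le> D' * \<rho> y" using bd(2)[OF y'(3) y(2)] D' by (intro mult_left_mono) auto
    finally show ?thesis by simp
  qed
  have "tail (2 * e) \<le> 2 * D' * tail e" if e: "0 < e" "e \<le> e0" for e
  proof -
    have "ennreal (tail (2 * e)) = (\<integral>\<^sup>+y. ennreal (\<rho> y) * indicator {c - 2 * e<..} y \<partial>lborel)"
      using prob_F_in[of "{c - 2 * e<..}" 0] by (simp add: tail_def)
    \<comment> \<open>The substitution fixes \<open>c\<close> and doubles the distance to it; its
      Jacobian gives the other factor of the constant \<open>2 * D'\<close>.\<close>
    also have "\<dots> = ennreal 2 * (\<integral>\<^sup>+y. ennreal (\<rho> (- c + 2 * y)) * indicator {c - 2 * e<..} (- c + 2 * y) \<partial>lborel)"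
      by (subst nn_integral_real_affine[where c = "2" and t = "- c"]) simp_all
    also have "\<dots> \<le> ennreal 2 * (\<integral>\<^sup>+y. ennreal D' * (ennreal (\<rho> y) * indicator {c - e<..} y) \<partial>lborel)"
    proof (intro mult_left_mono nn_integral_mono)
      fix y
      show "ennreal (\<rho> (- c + 2 * y)) * indicator {c - 2 * e<..} (- c + 2 * y) \<le>
          ennreal D' * (ennreal (\<rho> y) * indicator {c - e<..} y)"
      proof (cases "c - e < y \<and> y < c")
        case True
        then have "\<rho> (2 * y - c) \<le> D' * \<rho> y" using e by (intro cmp) auto
        then have "ennreal (\<rho> (2 * y - c)) \<le> ennreal D' * ennreal (\<rho> y)"
          using D' by (simp add: ennreal_mult'[symmetric] ennreal_leI)
        then show ?thesis using True by (simp add: indicator_def add.commute)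
      next
        case False
        then have "y \<le> c - e \<or> c \<le> - c + 2 * y" by auto
        then show ?thesis
        proof
          assume "c \<le> - c + 2 * y"
          then have "\<rho> (- c + 2 * y) = 0" by (intro rho_zero) auto
          then show ?thesis by simp
        qed (auto simp: indicator_def)
      qed
    qed auto
    also have "\<dots> = ennreal 2 * (ennreal D' * ennreal (tail e))"
      using prob_F_in[of "{c - e<..}" 0] by (simp add: tail_def nn_integral_cmult)
    also have "\<dots> = ennreal (2 * D' * tail e)"
      using D' tail_nonneg[of e] by (simp add: ennreal_mult[symmetric] mult.assoc del: ennreal_numeral)
    finally show ?thesis using D' tail_nonneg[of e] by (simp add: ennreal_le_iff)
  qed
  moreover have "0 < e0" using b by (simp add: e0_def)
  ultimately show ?thesis using D' by (intro exI[of _ "2 * D'"] exI[of _ e0]) auto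
qed

lemma tail_scaling:
  assumes "0 < C"
  shows "\<exists>D e0. 0 < D \<and> 0 < e0 \<and> (\<forall>e. 0 < e \<and> e \<le> e0 \<longrightarrow> tail (C * e) \<le> D * tail e)"
proof -
  obtain D e0 where D: "0 < D" "0 < e0" and dbl: "\<And>e. 0 < e \<Longrightarrow> e \<le> e0 \<Longrightarrow> tail (2 * e) \<le> D * tail e"
    using tail_doubling by blast
  have it: "tail (2 ^ k * e) \<le> D ^ k * tail e" if "0 < e" "e \<le> e0 / 2 ^ k" for k e
    using that
  proof (induction k)
    case (Suc k)
    have p2: "(0::real) < 2 ^ k" by simp
    have a: "2 * e * 2 ^ k \<le> e0" using Suc.prems by (simp add: field_simps)
    have b: "0 \<le> e * 2 ^ k" using Suc.prems by simp
    from a b have *: "e * 2 ^ k \<le> e0" by linarith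
    have "tail (2 ^ Suc k * e) = tail (2 * (2 ^ k * e))" by (simp add: mult_ac)
    also have "\<dots> \<le> D * tail (2 ^ k * e)"
      using * Suc.prems by (intro dbl) (auto simp: mult.commute)
    also have "\<dots> \<le> D * (D ^ k * tail e)"
      using Suc.IH Suc.prems(1) * D(1) p2 by (intro mult_left_mono) (auto simp: field_simps)
    finally show ?case by simp
  qed simp
  obtain k :: nat where k: "C < 2 ^ k" using real_arch_pow[of 2 C] by auto
  have "tail (C * e) \<le> D ^ k * tail e" if "0 < e" "e \<le> e0 / 2 ^ k" for e
  proof -
    have "tail (C * e) \<le> tail (2 ^ k * e)" using k that by (intro tail_mono mult_right_mono) auto
    then show ?thesis using it[OF that] by linarith
  qed
  then show ?thesis using D by (intro exI[of _ "D ^ k"] exI[of _ "e0 / 2 ^ k"]) auto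
qed

section \<open>Probabilities of small gaps\<close>

lemma prob_env_pair:
  assumes jk: "j \<noteq> k" and [measurable]: "A \<in> sets borel" "A' \<in> sets borel"
  shows "prob {\<omega> \<in> space M. env_var j \<omega> \<in> A \<and> env_var k \<omega> \<in> A'} =
    prob {\<omega> \<in> space M. env_var j \<omega> \<in> A} * prob {\<omega> \<in> space M. env_var k \<omega> \<in> A'}"
proof -
  define S where "S i = (if i = j then A else A')" for i
  have "prob (\<Inter>i\<in>{j, k}. env_var i -` S i \<inter> space M) = (\<Prod>i\<in>{j, k}. prob (env_var i -` S i \<inter> space M))"
    by (rule indep_varsD[OF indep_env]) (auto simp: S_def)
  moreover have "(\<Inter>i\<in>{j, k}. env_var i -` S i \<inter> space M) = {\<omega> \<in> space M. env_var j \<omega> \<in> A \<and> env_var k \<omega> \<in> A'}"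
    using jk by (auto simp: S_def)
  moreover have "env_var j -` A \<inter> space M = {\<omega> \<in> space M. env_var j \<omega> \<in> A}"
    "env_var k -` A' \<inter> space M = {\<omega> \<in> space M. env_var k \<omega> \<in> A'}" by auto
  ultimately show ?thesis using jk by (simp add: S_def)
qed

lemma prob_good_edge:
  assumes "x \<noteq> y"
  shows "prob {\<omega> \<in> space M. F \<omega> x > c - e \<and> F \<omega> y < e - c} = (tail e)\<^sup>2"
  using prob_env_pair[of "Inl x" "Inl y" "{c - e<..}" "{..< e - c}"] assms
  by (simp add: tail_eq tail_eq_neg power2_eq_square)

text \<open>A gap of at most \<open>d\<close> forces the two values to lie within \<open>d\<close>,
  hence within \<open>2 * d\<close>, of opposite ends of \<open>(-c, c)\<close>. The factor 2 counts
  which value is near \<open>c\<close>.\<close>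

lemma prob_gap_le:
  assumes d: "0 < d"
  shows "prob {\<omega> \<in> space M. dgap c (F \<omega>) x \<le> d} \<le> 2 * (tail (2 * d))\<^sup>2"
proof -
  let ?E = "\<lambda>x y. {\<omega> \<in> space M. F \<omega> x > c - 2 * d \<and> F \<omega> y < 2 * d - c}"
  have "prob {\<omega> \<in> space M. dgap c (F \<omega>) x \<le> d} \<le> prob (?E x (x + 1) \<union> ?E (x + 1) x)"
  proof (rule finite_measure_mono_AE)
    show "AE \<omega> in M. \<omega> \<in> {\<omega> \<in> space M. dgap c (F \<omega>) x \<le> d} \<longrightarrow> \<omega> \<in> ?E x (x + 1) \<union> ?E (x + 1) x"
      using AE_F_bounded[of x] AE_F_bounded[of "x + 1"]
    proof eventually_elim
      case (elim \<omega>)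
      show ?case
      proof
        assume "\<omega> \<in> {\<omega> \<in> space M. dgap c (F \<omega>) x \<le> d}"
        then have "\<omega> \<in> space M" "2 * c - \<bar>F \<omega> (x + 1) - F \<omega> x\<bar> \<le> d" by (auto simp: dgap_def)
        moreover from this(2) elim d have "(F \<omega> x > c - 2 * d \<and> F \<omega> (x + 1) < 2 * d - c) \<or>
           (F \<omega> (x + 1) > c - 2 * d \<and> F \<omega> x < 2 * d - c)"
          by argo
        ultimately show "\<omega> \<in> ?E x (x + 1) \<union> ?E (x + 1) x" by auto
      qed
    qed
  qed auto
  also have "\<dots> \<le> prob (?E x (x + 1)) + prob (?E (x + 1) x)"
    by (intro measure_Un_le) auto
  also have "\<dots> = 2 * (tail (2 * d))\<^sup>2" by (simp add: prob_good_edge)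
  finally show ?thesis .
qed

text \<open>Only the disjoint edges between \<open>2 * j\<close> and \<open>2 * j + 1\<close> are
  tried, since these are independent.\<close>

lemma prob_no_good_edge:
  "prob {\<omega> \<in> space M. \<forall>j<m. \<not> (F \<omega> (2 * int j) > c - e \<and> F \<omega> (2 * int j + 1) < e - c)} \<le> exp (- (real m * (tail e)\<^sup>2))"
proof (cases "m = 0")
  case False
  define S where "S = {u::real \<times> real. fst u > c - e \<and> snd u < e - c}"
  have [measurable]: "S \<in> sets (borel \<Otimes>\<^sub>M borel)"
  proof -
    have "{u \<in> space (borel \<Otimes>\<^sub>M borel). fst u > c - e \<and> snd u < e - c} \<in> sets (borel \<Otimes>\<^sub>M borel :: (real \<times> real) measure)"
      by measurable
    then show ?thesis by (simp add: S_def space_pair_measure)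
  qed
  define Y :: "nat \<Rightarrow> 'w \<Rightarrow> real" where
    "Y j \<omega> = indicator S (env_var (Inl (2 * int j)) \<omega>, env_var (Inl (2 * int j + 1)) \<omega>)" for j \<omega>
  have ind: "indep_vars (\<lambda>_. borel) Y UNIV"
    unfolding Y_def
  proof (rule indep_vars_pairs[OF indep_env])
    show "disjoint_family_on (\<lambda>j. {Inl (2 * int j), Inl (2 * int j + 1)}) UNIV"
      by (rule disjoint_family_on_pairs[of Inl 0, simplified])
  qed measurable
  have Y0: "Y j -` {0} \<inter> space M = space M - {\<omega> \<in> space M. F \<omega> (2 * int j) > c - e \<and> F \<omega> (2 * int j + 1) < e - c}" for j
    by (auto simp: Y_def S_def)
  have "{\<omega> \<in> space M. \<forall>j<m. \<not> (F \<omega> (2 * int j) > c - e \<and> F \<omega> (2 * int j + 1) < e - c)} =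
      (\<Inter>j\<in>{..<m}. Y j -` {0} \<inter> space M)"
    using False unfolding Y0 by auto
  also have "prob \<dots> = (\<Prod>j\<in>{..<m}. prob (Y j -` {0} \<inter> space M))"
    using False by (intro indep_varsD[OF ind]) auto
  also have "\<dots> = (1 - (tail e)\<^sup>2) ^ m"
    unfolding Y0 by (simp add: prob_compl prob_good_edge)
  also have "\<dots> \<le> exp (- (tail e)\<^sup>2) ^ m"
  proof (rule power_mono)
    show "1 - (tail e)\<^sup>2 \<le> exp (- (tail e)\<^sup>2)" using exp_ge_add_one_self[of "- (tail e)\<^sup>2"] by simp
    show "0 \<le> 1 - (tail e)\<^sup>2" using tail_nonneg[of e] tail_le_1[of e] by (simp add: power_le_one)
  qed
  also have "\<dots> = exp (- (real m * (tail e)\<^sup>2))" by (simp add: exp_of_nat_mult[symmetric])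
  finally show ?thesis .
qed simp

text \<open>The balance \<open>L * tail (L / n)\<^sup>2 \<approx> 1\<close> says that the best edge within distance \<open>L\<close> of the origin has
  gap of order \<open>L / n\<close>, so that travelling to it and staying there until time \<open>n\<close> cost equally much.\<close>
definition scale :: "nat \<Rightarrow> nat" where
  "scale n = Max {L. 1 \<le> L \<and> L \<le> n \<and> real L * (tail (real L / real n))\<^sup>2 \<le> 1}"

section \<open>Asymptotics of the localization scale\<close>

lemma scale_props:
  assumes "1 \<le> n"
  shows "1 \<le> scale n" "scale n \<le> n" "real (scale n) * (tail (real (scale n) / real n))\<^sup>2 \<le> 1"
    and scale_maximal: "\<And>L. 1 \<le> L \<Longrightarrow> L \<le> n \<Longrightarrow> real L * (tail (real L / real n))\<^sup>2 \<le> 1 \<Longrightarrow> L \<le> scale n"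
proof -
  let ?S = "{L. 1 \<le> L \<and> L \<le> n \<and> real L * (tail (real L / real n))\<^sup>2 \<le> 1}"
  have fin: "finite ?S" by (rule finite_subset[of _ "{..n}"]) auto
  \<comment> \<open>The maximum is over a nonempty set because a squared probability never exceeds
    1.\<close>
  have "1 \<in> ?S" using assms tail_nonneg tail_le_1 by (auto simp: power_le_one)
  then have "scale n \<in> ?S" unfolding scale_def using Max_in[OF fin] by blast
  then show "1 \<le> scale n" "scale n \<le> n" "real (scale n) * (tail (real (scale n) / real n))\<^sup>2 \<le> 1" by auto
  show "L \<le> scale n" if "1 \<le> L" "L \<le> n" "real L * (tail (real L / real n))\<^sup>2 \<le> 1" for L
    unfolding scale_def using that by (intro Max_ge[OF fin]) auto
qed

text \<open>Any fixed \<open>m\<close> is eventually a candidate in the maximum, since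
  \<open>tail (m / n)\<close> becomes small.\<close>

lemma scale_at_top: "filterlim scale at_top sequentially"
  unfolding filterlim_at_top
proof
  fix m0 :: nat
  define m where "m = Suc m0"
  obtain e where e: "0 < e" "tail e < 1 / real m" using tail_small[of "1 / real m"] by (auto simp: m_def)
  have "eventually (\<lambda>n. real n \<ge> max (real m / e) (real m)) sequentially"
    using filterlim_real_sequentially by (simp only: filterlim_at_top)
  then show "eventually (\<lambda>n. m0 \<le> scale n) sequentially"
  proof eventually_elim
    case (elim n)
    have n: "m \<le> n" "1 \<le> n" "real m / real n \<le> e" using elim e by (auto simp: m_def field_simps)
    have "tail (real m / real n) \<le> tail e" using n by (intro tail_mono)
    then have t: "tail (real m / real n) \<le> 1 / real m" using e by simp
    have "(tail (real m / real n))\<^sup>2 \<le> tail (real m / real n)"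
      using tail_nonneg[of "real m / real n"] tail_le_1[of "real m / real n"] by (simp add: power2_eq_square mult_left_le)
    then have "real m * (tail (real m / real n))\<^sup>2 \<le> real m * (1 / real m)"
      using t by (intro mult_left_mono) auto
    then have "m \<le> scale n" using n by (intro scale_maximal) (auto simp: m_def)
    then show ?case by (simp add: m_def)
  qed
qed

text \<open>A scale of at least \<open>r * n\<close> would make the balance at least
  \<open>r * n * (tail r)\<^sup>2\<close>, which exceeds 1 for large \<open>n\<close>. The
  positivity of the tail is what counts.\<close>

lemma scale_ratio: "(\<lambda>n. real (scale n) / real n) \<longlonglongrightarrow> 0"
proof (rule tendstoI)
  fix r :: real assume r: "0 < r"
  have "0 < tail r" using tail_pos[OF r] .
  have "eventually (\<lambda>n. real n \<ge> max 1 (2 / (r * (tail r)\<^sup>2))) sequentially"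
    using filterlim_real_sequentially by (simp only: filterlim_at_top)
  then show "eventually (\<lambda>n. dist (real (scale n) / real n) 0 < r) sequentially"
  proof eventually_elim
    case (elim n)
    have n: "1 \<le> n" "real n \<ge> 2 / (r * (tail r)\<^sup>2)" using elim by auto
    show ?case
    proof (rule ccontr)
      assume "\<not> ?thesis"
      then have ge: "r \<le> real (scale n) / real n" by simp
      then have "r * real n \<le> real (scale n)" using n by (simp add: field_simps)
      moreover have "(tail r)\<^sup>2 \<le> (tail (real (scale n) / real n))\<^sup>2"
        using ge tail_nonneg by (intro power_mono tail_mono) auto
      ultimately have "r * real n * (tail r)\<^sup>2 \<le> real (scale n) * (tail (real (scale n) / real n))\<^sup>2"
        using r by (intro mult_mono) auto
      also have "\<dots> \<le> 1" using scale_props(3)[OF n(1)] .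
      finally have "r * real n * (tail r)\<^sup>2 \<le> 1" .
      moreover have "2 \<le> r * real n * (tail r)\<^sup>2" using n(2) r \<open>0 < tail r\<close> by (simp add: field_simps)
      ultimately show False by simp
    qed
  qed
qed

text \<open>By maximality the balance exceeds 1 at \<open>scale n + 1\<close>, which is at most
  \<open>2 * scale n\<close>; \<open>scale_ratio\<close> guarantees that this candidate is still at
  most \<open>n\<close>.\<close>

lemma scale_lower: "eventually (\<lambda>n. 1 / 2 \<le> real (scale n) * (tail (2 * real (scale n) / real n))\<^sup>2) sequentially"
proof -
  have "eventually (\<lambda>n. real (scale n) / real n < 1 / 2) sequentially"
    using scale_ratio by (rule order_tendstoD(2)) simp
  then show ?thesis using eventually_ge_at_top[of 2]
  proof eventually_elim
    case (elim n)
    define L where "L = scale n"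
    have L: "1 \<le> L" using scale_props(1) elim by (simp add: L_def)
    have "real L < real n / 2" using elim by (simp add: L_def field_simps)
    then have "Suc L \<le> n" by linarith
    then have "\<not> real (Suc L) * (tail (real (Suc L) / real n))\<^sup>2 \<le> 1"
      using scale_maximal[of n "Suc L"] elim by (auto simp: L_def)
    then have "1 \<le> real (Suc L) * (tail (real (Suc L) / real n))\<^sup>2" by simp
    also have "\<dots> \<le> (2 * real L) * (tail (2 * real L / real n))\<^sup>2"
      using L tail_nonneg by (intro mult_mono power_mono tail_mono divide_right_mono) auto
    finally show ?case by (simp add: L_def)
  qed
qed

end

subsection \<open>The shape function\<close>

locale random_env_shape = random_env +
  fixes \<Lambda> :: "real \<Rightarrow> real"
  assumes shape: "\<And>\<alpha>. -1 \<le> \<alpha> \<Longrightarrow> \<alpha> \<le> 1 \<Longrightarrow>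
                  AE \<omega> in M. (\<lambda>n. min_action (B \<omega>) (F \<omega>) n (round0 (\<alpha> * real n)) / real n)
                                 \<longlonglongrightarrow> - \<Lambda> \<alpha>"
begin

definition G :: "real \<Rightarrow> real" where "G \<alpha> = c - \<Lambda> \<alpha>"

lemma AE_shape_limit:
  assumes "-1 \<le> \<alpha>" "\<alpha> \<le> 1" shows "AE \<omega> in M. shape_limit c (B \<omega>) (F \<omega>) G \<alpha>"
  using shape[OF assms]
proof eventually_elim
  case (elim \<omega>)
  have "(\<lambda>n. c + min_action (B \<omega>) (F \<omega>) n (round0 (\<alpha> * real n)) / real n) \<longlonglongrightarrow> c + - \<Lambda> \<alpha>"
    by (intro tendsto_add tendsto_const elim)
  moreover have "eventually (\<lambda>n. c + min_action (B \<omega>) (F \<omega>) n (round0 (\<alpha> * real n)) / real n =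
      excess c (B \<omega>) (F \<omega>) n (round0 (\<alpha> * real n)) / real n) sequentially"
    using eventually_gt_at_top[of 0] by eventually_elim (simp add: excess_def add_divide_distrib)
  ultimately show ?case
    unfolding shape_limit_def G_def by (auto intro: Lim_transform_eventually)
qed

lemma AE_shape_limit_reflect:
  assumes "-1 \<le> \<alpha>" "\<alpha> \<le> 1" shows "AE \<omega> in M. shape_limit c (B \<omega>) (\<lambda>x. F \<omega> (- x)) G \<alpha>"
  using AE_env_pred_invariant[OF measurable_shape_limit _ _ AE_shape_limit[OF assms], of id uminus]
  by (simp add: inj_def)

lemma AE_excess_above:
  assumes \<sigma>: "0 \<le> \<sigma>" and m: "0 \<le> m" and \<epsilon>: "0 < \<epsilon>"
    and GG: "\<And>\<alpha>. \<sigma> \<le> \<alpha> \<Longrightarrow> \<alpha> \<le> 1 \<Longrightarrow> m * \<alpha> \<le> G \<alpha>"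
  shows "AE \<omega> in M. \<exists>t0. excess_above c (B \<omega>) (F \<omega>) \<sigma> m \<epsilon> t0"
proof -
  \<comment> \<open>Only countably many slopes occur as \<open>j\<close> and \<open>H\<close> vary,
    so a single null set serves all of them.\<close>
  have *: "AE \<omega> in M. \<sigma> + real j / real (Suc H) \<le> 1 \<longrightarrow>
      shape_limit c (B \<omega>) (F \<omega>) G (\<sigma> + real j / real (Suc H)) \<and>
      shape_limit c (B \<omega>) (\<lambda>x. F \<omega> (- x)) G (\<sigma> + real j / real (Suc H))" for j H
  proof (cases "\<sigma> + real j / real (Suc H) \<le> 1")
    case True
    have "-1 \<le> \<sigma> + real j / real (Suc H)" using \<sigma> by (smt (verit) divide_nonneg_nonneg of_nat_0_le_iff)
    from AE_shape_limit[OF this True] AE_shape_limit_reflect[OF this True] show ?thesis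
      by eventually_elim simp
  qed simp
  then have "AE \<omega> in M. \<forall>j H. \<sigma> + real j / real (Suc H) \<le> 1 \<longrightarrow>
      shape_limit c (B \<omega>) (F \<omega>) G (\<sigma> + real j / real (Suc H)) \<and>
      shape_limit c (B \<omega>) (\<lambda>x. F \<omega> (- x)) G (\<sigma> + real j / real (Suc H))"
    unfolding AE_all_countable by blast
  then show ?thesis using AE_admissible_env
  proof eventually_elim
    case (elim \<omega>)
    show ?case
      by (rule excess_above_exists[OF elim(2) \<sigma> m \<epsilon>, of G]) (use elim(1) GG in auto)
  qed
qed

lemma AE_excess_below:
  assumes \<sigma>: "\<sigma> \<le> 1 / 4" and m: "0 \<le> m" and \<epsilon>: "0 < \<epsilon>"
    and GG: "\<And>\<alpha>. 0 \<le> \<alpha> \<Longrightarrow> \<alpha> \<le> \<sigma> \<Longrightarrow> G \<alpha> \<le> m * \<alpha>"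
  shows "AE \<omega> in M. \<exists>t0. excess_below c (B \<omega>) (F \<omega>) \<sigma> m \<epsilon> t0"
proof -
  have *: "AE \<omega> in M. real j / real (Suc H) \<le> 1 \<longrightarrow>
      shape_limit c (B \<omega>) (F \<omega>) G (real j / real (Suc H)) \<and>
      shape_limit c (B \<omega>) (\<lambda>x. F \<omega> (- x)) G (real j / real (Suc H))" for j H
  proof (cases "real j / real (Suc H) \<le> 1")
    case True
    have "-1 \<le> real j / real (Suc H)" by (smt (verit) divide_nonneg_nonneg of_nat_0_le_iff)
    from AE_shape_limit[OF this True] AE_shape_limit_reflect[OF this True] show ?thesis
      by eventually_elim simp
  qed simp
  then have "AE \<omega> in M. \<forall>j H. real j / real (Suc H) \<le> 1 \<longrightarrow>
      shape_limit c (B \<omega>) (F \<omega>) G (real j / real (Suc H)) \<and>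
      shape_limit c (B \<omega>) (\<lambda>x. F \<omega> (- x)) G (real j / real (Suc H))"
    unfolding AE_all_countable by blast
  then show ?thesis using AE_admissible_env
  proof eventually_elim
    case (elim \<omega>)
    show ?case
      by (rule excess_below_exists[OF elim(2) \<sigma> m \<epsilon>, of G]) (use elim(1) GG in auto)
  qed
qed

section \<open>Growth of the excess rate near speed zero\<close>

lemma G_nonneg:
  assumes "0 \<le> \<alpha>" "\<alpha> \<le> 1" shows "0 \<le> G \<alpha>"
proof -
  have ae: "AE \<omega> in M. shape_limit c (B \<omega>) (F \<omega>) G \<alpha> \<and> admissible_env c (B \<omega>) (F \<omega>)"
    using AE_shape_limit[of \<alpha>] AE_admissible_env assms by auto
  obtain \<omega> where "shape_limit c (B \<omega>) (F \<omega>) G \<alpha>" "admissible_env c (B \<omega>) (F \<omega>)"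
    using AE_positive_prob_exists[OF ae sets.top] prob_space by auto
  then show ?thesis unfolding shape_limit_def
    by (intro LIMSEQ_le_const) (auto intro!: divide_nonneg_nonneg excess_nonneg round0_le assms)
qed

text \<open>The limit is nonrandom, so for each \<open>\<epsilon>\<close> one sample suffices to
  bound it. With positive probability the edge at the origin is itself good, and staying on it costs
  at most \<open>\<epsilon>\<close> per step.\<close>

lemma G_0: "G 0 = 0"
proof -
  have "G 0 \<le> 0 + \<epsilon>" if \<epsilon>: "0 < \<epsilon>" for \<epsilon>
  proof -
    have ae: "AE \<omega> in M. shape_limit c (B \<omega>) (F \<omega>) G 0 \<and> admissible_env c (B \<omega>) (F \<omega>)"
      using AE_shape_limit[of 0] AE_admissible_env by auto
    have "0 < prob {\<omega> \<in> space M. F \<omega> 0 > c - \<epsilon> \<and> F \<omega> 1 < \<epsilon> - c}"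
      using tail_pos[OF \<epsilon>] by (simp add: prob_good_edge)
    then obtain \<omega> where \<omega>: "shape_limit c (B \<omega>) (F \<omega>) G 0" and env: "admissible_env c (B \<omega>) (F \<omega>)"
      and e: "F \<omega> 0 > c - \<epsilon>" "F \<omega> 1 < \<epsilon> - c"
      using AE_positive_prob_exists[OF ae, of "{\<omega> \<in> space M. F \<omega> 0 > c - \<epsilon> \<and> F \<omega> 1 < \<epsilon> - c}"] by auto
    have "excess c (B \<omega>) (F \<omega>) n (round0 (0 * real n)) / real n \<le> \<epsilon> + 2 * c / real n" if n: "2 \<le> n" for n
    proof -
      \<comment> \<open>One step is kept to return to 0, which is the source of the term
        \<open>2 * c / n\<close>.\<close>
      obtain \<gamma> where \<gamma>: "lazy_walk (n - 1) \<gamma>" "cost c (B \<omega>) (F \<omega>) \<gamma> 0 (n - 1) \<le> 2 * c * real 0 + \<epsilon> * real (n - 1)"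
        "\<bar>\<gamma> (n - 1)\<bar> \<le> int 0 + 1"
        using walk_to_edge[OF env, of \<epsilon> 0 "n - 1"] e \<epsilon> by auto
      have "excess c (B \<omega>) (F \<omega>) n 0 \<le> excess c (B \<omega>) (F \<omega>) (n - 1) (\<gamma> (n - 1)) + 2 * c * real (n - (n - 1))"
        using n \<gamma>(3) by (intro excess_extend[OF env]) auto
      also have "\<dots> \<le> \<epsilon> * real (n - 1) + 2 * c"
        using excess_le_cost[OF \<gamma>(1), of c "B \<omega>" "F \<omega>"] \<gamma>(2) n by simp
      also have "\<dots> \<le> \<epsilon> * real n + 2 * c" using \<epsilon> by simp
      finally show ?thesis using n by (simp add: round0_nonneg field_simps)
    qed
    then have "eventually (\<lambda>n. excess c (B \<omega>) (F \<omega>) n (round0 (0 * real n)) / real n \<le> \<epsilon> + 2 * c / real n) sequentially"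
      using eventually_ge_at_top[of 2] by (rule eventually_mono[rotated])
    moreover have "(\<lambda>n. \<epsilon> + 2 * c / real n) \<longlonglongrightarrow> \<epsilon> + 0"
      by (intro tendsto_add tendsto_const lim_const_over_n)
    ultimately show ?thesis using \<omega> unfolding shape_limit_def
      using tendsto_le[OF trivial_limit_sequentially, of "\<lambda>n. \<epsilon> + 2 * c / real n" "\<epsilon> + 0"] by simp
  qed
  then have "G 0 \<le> 0" by (rule field_le_epsilon)
  then show ?thesis using G_nonneg[of 0] by simp
qed

text \<open>Wait near the origin for the fraction \<open>1 - l\<close> of the time, which costs nothing to leading order.\<close>
lemma G_star:
  assumes l: "0 < l" "l < 1" and \<alpha>: "0 \<le> \<alpha>" "\<alpha> \<le> 1"
  shows "G (l * \<alpha>) \<le> l * G \<alpha>"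
proof (rule field_le_epsilon)
  fix \<epsilon>' :: real assume \<epsilon>': "0 < \<epsilon>'"
  define \<epsilon> where "\<epsilon> = \<epsilon>' / 4"
  have \<epsilon>: "0 < \<epsilon>" using \<epsilon>' by (simp add: \<epsilon>_def)
  define m where "m n = nat \<lfloor>l * real n\<rfloor>" for n
  \<comment> \<open>The three spare steps absorb the rounding mismatch between the endpoints for
    \<open>l * \<alpha> * n\<close> and \<open>\<alpha> * m n\<close>.\<close>
  define s where "s n = n - m n - 3" for n
  have m_le: "real (m n) \<le> l * real n" and m_ge: "l * real n - 1 \<le> real (m n)" for n
    using l by (auto simp: m_def)
  have la: "0 \<le> l * \<alpha>" "l * \<alpha> \<le> 1" using l \<alpha> by (auto simp: mult_le_one)
  have m_top: "filterlim m at_top sequentially"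
  proof -
    have "LIM n sequentially. l * real n :> at_top"
      using l by (intro filterlim_tendsto_pos_mult_at_top[OF tendsto_const] filterlim_real_sequentially)
    from filterlim_compose[OF filterlim_nat_sequentially filterlim_compose[OF filterlim_floor_sequentially this]]
    show ?thesis by (simp add: m_def[abs_def])
  qed
  have s_top: "filterlim s at_top sequentially"
    unfolding filterlim_at_top
  proof
    fix Z :: nat
    have "eventually (\<lambda>n. real n \<ge> (real Z + 3) / (1 - l)) sequentially"
      using filterlim_real_sequentially by (simp only: filterlim_at_top)
    then show "eventually (\<lambda>n. Z \<le> s n) sequentially"
    proof eventually_elim
      case (elim n)
      then have "real Z + 3 \<le> (1 - l) * real n" using l by (simp add: field_simps)
      then have "real Z + 3 + real (m n) \<le> real n" using m_le[of n] by (simp add: algebra_simps)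
      then show ?case by (simp add: s_def)
    qed
  qed
  define A where "A n = {\<omega> \<in> space M. G (l * \<alpha>) - \<epsilon> < excess c (B \<omega>) (F \<omega>) n (round0 (l * \<alpha> * real n)) / real n}" for n
  define C where "C n = {\<omega> \<in> space M. excess c (B \<omega>) (F \<omega>) (s n) (round0 (0 * real (s n))) / real (s n) < G 0 + \<epsilon>}" for n
  define D0 where "D0 n = {\<omega> \<in> space M. excess c (B \<omega>) (F \<omega>) (m n) (round0 (\<alpha> * real (m n))) / real (m n) < G \<alpha> + \<epsilon>}" for n
  \<comment> \<open>The restart time varies with \<open>n\<close>, so almost sure convergence does
    not carry over; \<open>D n\<close> is used through having the same probability as
    \<open>D0 n\<close>.\<close>
  define D where "D n = {\<omega> \<in> space M. excess c (\<lambda>i. B \<omega> (i + int (s n))) (F \<omega>) (m n) (round0 (\<alpha> * real (m n))) / real (m n) < G \<alpha> + \<epsilon>}" for n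
  have meas: "measurable_env_pred (\<lambda>b f. excess c b f n k / z < a)" "measurable_env_pred (\<lambda>b f. a < excess c b f n k / z)" for n k z a
    unfolding measurable_env_pred_def by measurable
  have ev: "A n \<in> events" "C n \<in> events" "D0 n \<in> events" "D n \<in> events" for n
    unfolding A_def C_def D0_def D_def by (intro env_pred_sets meas prob_shift)+
  have pA: "(\<lambda>n. prob (A n)) \<longlonglongrightarrow> 1"
  proof (rule prob_tendsto_1_if_AE_eventually[OF ev(1)])
    show "AE \<omega> in M. eventually (\<lambda>n. \<omega> \<in> A n) sequentially"
      using AE_shape_limit[OF order_trans[OF _ la(1)] la(2), simplified] AE_space
    proof eventually_elim
      case (elim \<omega>)
      then have "eventually (\<lambda>n. G (l * \<alpha>) - \<epsilon> < excess c (B \<omega>) (F \<omega>) n (round0 (l * \<alpha> * real n)) / real n) sequentially"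
        unfolding shape_limit_def using \<epsilon> by (intro order_tendstoD(1)) auto
      then show ?case using elim by (auto simp: A_def)
    qed
  qed
  have lim: "(\<lambda>n. prob {\<omega> \<in> space M. excess c (B \<omega>) (F \<omega>) (k n) (round0 (\<beta> * real (k n))) / real (k n) < G \<beta> + \<epsilon>}) \<longlonglongrightarrow> 1"
    if \<beta>: "0 \<le> \<beta>" "\<beta> \<le> 1" and k: "filterlim k at_top sequentially" for \<beta> k
  proof (rule prob_tendsto_1_if_AE_eventually)
    show "{\<omega> \<in> space M. excess c (B \<omega>) (F \<omega>) (k n) (round0 (\<beta> * real (k n))) / real (k n) < G \<beta> + \<epsilon>} \<in> events" for n
      by (intro env_pred_sets meas)
    show "AE \<omega> in M. eventually (\<lambda>n. \<omega> \<in> {\<omega> \<in> space M. excess c (B \<omega>) (F \<omega>) (k n) (round0 (\<beta> * real (k n))) / real (k n) < G \<beta> + \<epsilon>}) sequentially"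
      using AE_shape_limit[OF order_trans[OF _ \<beta>(1)] \<beta>(2), simplified] AE_space
    proof eventually_elim
      case (elim \<omega>)
      then have "eventually (\<lambda>n. excess c (B \<omega>) (F \<omega>) n (round0 (\<beta> * real n)) / real n < G \<beta> + \<epsilon>) sequentially"
        unfolding shape_limit_def using \<epsilon> by (intro order_tendstoD(2)) auto
      from eventually_compose_filterlim[OF this k] show ?case using elim by auto
    qed
  qed
  have pC: "(\<lambda>n. prob (C n)) \<longlonglongrightarrow> 1" unfolding C_def by (rule lim) (auto intro: s_top)
  have "(\<lambda>n. prob (D0 n)) \<longlonglongrightarrow> 1" unfolding D0_def by (rule lim) (auto intro: m_top \<alpha>)
  moreover have "prob (D n) = prob (D0 n)" for n
    unfolding D_def D0_def by (rule prob_shift(4)[OF meas(1)])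
  ultimately have pD: "(\<lambda>n. prob (D n)) \<longlonglongrightarrow> 1" by simp
  have "(\<lambda>n. prob (A n \<inter> (C n \<inter> D n))) \<longlonglongrightarrow> 1"
    by (intro prob_tendsto_1_Int sets.Int ev pA pC pD)
  then have "eventually (\<lambda>n. 1 / 2 < prob (A n \<inter> (C n \<inter> D n))) sequentially"
    by (rule order_tendstoD(1)) simp
  moreover have "eventually (\<lambda>n. 1 \<le> s n) sequentially" "eventually (\<lambda>n. 1 \<le> m n) sequentially"
    using s_top m_top by (auto simp: filterlim_at_top)
  moreover have "eventually (\<lambda>n. real n \<ge> 6 * c / \<epsilon>) sequentially"
    using filterlim_real_sequentially by (simp only: filterlim_at_top)
  ultimately have "eventually (\<lambda>n. 1 / 2 < prob (A n \<inter> (C n \<inter> D n)) \<and> 1 \<le> s n \<and> 1 \<le> m n \<and> real n \<ge> 6 * c / \<epsilon>) sequentially"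
    by (intro eventually_conj)
  then obtain n where n: "1 / 2 < prob (A n \<inter> (C n \<inter> D n))" "1 \<le> s n" "1 \<le> m n" "real n \<ge> 6 * c / \<epsilon>"
    by (auto simp: eventually_sequentially)
  obtain \<omega> where \<omega>: "\<omega> \<in> A n" "\<omega> \<in> C n" "\<omega> \<in> D n" and env: "admissible_env c (B \<omega>) (F \<omega>)"
    using AE_positive_prob_exists[OF AE_admissible_env, of "A n \<inter> (C n \<inter> D n)"] ev n(1) by auto
  define k where "k = round0 (\<alpha> * real (m n))"
  have n3: "s n + m n = n - 3" "n \<ge> 3" "n > 0" using n(2) by (auto simp: s_def)
  have k: "\<bar>k\<bar> \<le> int (m n)" unfolding k_def using \<alpha> by (rule round0_le)
  have dist: "\<bar>round0 (l * \<alpha> * real n) - k\<bar> \<le> int (n - (n - 3))"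
  proof -
    have "\<alpha> * real (m n) \<le> \<alpha> * (l * real n)" using m_le[of n] \<alpha> by (intro mult_left_mono) auto
    moreover have "\<alpha> * (l * real n - 1) \<le> \<alpha> * real (m n)" using m_ge[of n] \<alpha> by (intro mult_left_mono) auto
    ultimately have "\<alpha> * real (m n) \<le> l * \<alpha> * real n" "l * \<alpha> * real n \<le> \<alpha> * real (m n) + 1"
      using \<alpha> by (auto simp: algebra_simps)
    moreover have "round0 (l * \<alpha> * real n) = \<lfloor>l * \<alpha> * real n\<rfloor>" "k = \<lfloor>\<alpha> * real (m n)\<rfloor>"
      unfolding k_def using la \<alpha> by (auto intro!: round0_nonneg)
    ultimately have "\<bar>round0 (l * \<alpha> * real n) - k\<bar> \<le> 3" by linarith
    then show ?thesis using n3 by simp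
  qed
  have "excess c (B \<omega>) (F \<omega>) n (round0 (l * \<alpha> * real n)) \<le> excess c (B \<omega>) (F \<omega>) (n - 3) k + 2 * c * real (n - (n - 3))"
    using k n3 dist by (intro excess_extend[OF env]) auto
  also have "excess c (B \<omega>) (F \<omega>) (n - 3) k \<le> excess c (B \<omega>) (F \<omega>) (s n) 0 + excess c (\<lambda>i. B \<omega> (i + int (s n))) (F \<omega>) (m n) k"
    using excess_restart[OF k, of c "B \<omega>" "F \<omega>" "s n"] n3 by simp
  finally have 1: "excess c (B \<omega>) (F \<omega>) n (round0 (l * \<alpha> * real n)) \<le>
    excess c (B \<omega>) (F \<omega>) (s n) 0 + excess c (\<lambda>i. B \<omega> (i + int (s n))) (F \<omega>) (m n) k + 6 * c"
    using n3 by simp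
  have 2: "excess c (B \<omega>) (F \<omega>) (s n) 0 \<le> \<epsilon> * real (s n)"
    using \<omega>(2) n(2) by (simp add: C_def G_0 round0_nonneg field_simps)
  have "\<epsilon> * real (s n) \<le> \<epsilon> * real n" using \<epsilon> by (intro mult_left_mono) (auto simp: s_def)
  with 2 have 2: "excess c (B \<omega>) (F \<omega>) (s n) 0 \<le> \<epsilon> * real n" by simp
  have "excess c (\<lambda>i. B \<omega> (i + int (s n))) (F \<omega>) (m n) k \<le> (G \<alpha> + \<epsilon>) * real (m n)"
    using \<omega>(3) n(3) by (simp add: D_def k_def field_simps)
  also have "\<dots> \<le> (G \<alpha> + \<epsilon>) * (l * real n)"
    using m_le[of n] G_nonneg[OF \<alpha>] \<epsilon> by (intro mult_left_mono) auto
  finally have 3: "excess c (\<lambda>i. B \<omega> (i + int (s n))) (F \<omega>) (m n) k \<le> (G \<alpha> + \<epsilon>) * (l * real n)" .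
  have 4: "6 * c \<le> \<epsilon> * real n" using n(4) \<epsilon> by (simp add: field_simps)
  have 5: "(G (l * \<alpha>) - \<epsilon>) * real n < excess c (B \<omega>) (F \<omega>) n (round0 (l * \<alpha> * real n))"
    using \<omega>(1) n3 by (simp add: A_def field_simps)
  have "(G (l * \<alpha>) - \<epsilon>) * real n \<le> (l * G \<alpha> + l * \<epsilon> + 2 * \<epsilon>) * real n"
    using 1 2 3 4 5 by (simp add: algebra_simps)
  then have "G (l * \<alpha>) - \<epsilon> \<le> l * G \<alpha> + l * \<epsilon> + 2 * \<epsilon>" using n3 by (simp add: mult_le_cancel_right)
  moreover have "l * \<epsilon> \<le> \<epsilon>" using l \<epsilon> by simp
  ultimately show "G (l * \<alpha>) \<le> l * G \<alpha> + \<epsilon>'" by (simp add: \<epsilon>_def)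
qed

lemma G_slope_mono:
  assumes "0 < a" "a \<le> b" "b \<le> 1" shows "G a / a \<le> G b / b"
proof (cases "a = b")
  case False
  have "G (a / b * b) \<le> a / b * G b" using assms False by (intro G_star) auto
  then show ?thesis using assms by (simp add: field_simps)
qed simp

text \<open>By \<open>G_slope_mono\<close> this infimum is the limit of the slopes at 0.\<close>

definition g :: real where "g = (INF a\<in>{0<..1}. G a / a)"

lemma g_bdd: "bdd_below ((\<lambda>a. G a / a) ` {0<..1})"
  by (rule bdd_belowI[of _ 0]) (auto intro!: divide_nonneg_nonneg G_nonneg)

lemma g_nonneg: "0 \<le> g"
  unfolding g_def by (rule cINF_greatest) (auto intro!: divide_nonneg_nonneg G_nonneg)

lemma g_le:
  assumes "0 \<le> \<alpha>" "\<alpha> \<le> 1" shows "g * \<alpha> \<le> G \<alpha>"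
proof (cases "\<alpha> = 0")
  case False
  then have "g \<le> G \<alpha> / \<alpha>" unfolding g_def using assms by (intro cINF_lower[OF g_bdd]) auto
  then show ?thesis using assms False by (simp add: field_simps)
qed (simp add: G_0)

text \<open>The cap 1/4 on \<open>\<sigma>\<close> is the one that \<open>AE_excess_below\<close>
  asks for.\<close>

lemma g_approx:
  assumes "0 < \<eta>" shows "\<exists>\<sigma>>0. \<sigma> \<le> 1 / 4 \<and> (\<forall>\<alpha>. 0 \<le> \<alpha> \<and> \<alpha> \<le> \<sigma> \<longrightarrow> G \<alpha> \<le> (g + \<eta>) * \<alpha>)"
proof -
  have "\<exists>a\<in>{0<..1}. G a / a < g + \<eta>"
    using assms cINF_less_iff[OF _ g_bdd, of "g + \<eta>"] by (auto simp: g_def[symmetric])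
  then obtain a where a: "0 < a" "a \<le> 1" "G a / a < g + \<eta>" by auto
  have "G \<alpha> \<le> (g + \<eta>) * \<alpha>" if "0 \<le> \<alpha>" "\<alpha> \<le> min a (1 / 4)" for \<alpha>
  proof (cases "\<alpha> = 0")
    case False
    then have "G \<alpha> / \<alpha> \<le> G a / a" using that a by (intro G_slope_mono) auto
    then have "G \<alpha> / \<alpha> \<le> g + \<eta>" using a by simp
    then show ?thesis using False that by (simp add: field_simps)
  qed (simp add: G_0)
  then show ?thesis using a by (intro exI[of _ "min a (1 / 4)"]) auto
qed

end

subsection \<open>Localization of the minimizer\<close>

context random_env
begin

section \<open>Linear growth of site costs and of sign changes\<close>

lemma expectation_site:
  "expectation (\<lambda>\<omega>. c - \<bar>F \<omega> x\<bar>) = expectation (\<lambda>\<omega>. c - \<bar>F \<omega> 0\<bar>)"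
proof -
  have "expectation (\<lambda>\<omega>. c - \<bar>F \<omega> x\<bar>) = (\<integral>y. c - \<bar>y\<bar> \<partial>distr M borel (\<lambda>\<omega>. F \<omega> x))" for x
    by (subst integral_distr) auto
  then show ?thesis using distr_F_eq[of x 0] by simp
qed

lemma expectation_site_pos: "0 < expectation (\<lambda>\<omega>. c - \<bar>F \<omega> 0\<bar>)"
proof -
  have int: "integrable M (\<lambda>\<omega>. c - \<bar>F \<omega> 0\<bar>)"
    by (rule integrable_const_bound[where B = c]) (use AE_F_bounded[of 0] c_pos in \<open>auto elim!: eventually_mono\<close>)
  have "expectation (\<lambda>\<omega>. 0) < expectation (\<lambda>\<omega>. c - \<bar>F \<omega> 0\<bar>)"
  proof (rule integral_less_AE_space)
    show "AE \<omega> in M. 0 < c - \<bar>F \<omega> 0\<bar>" using AE_F_bounded[of 0] by eventually_elim simp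
    show "emeasure M (space M) \<noteq> 0" by (simp add: emeasure_space_1)
  qed (use int in auto)
  then show ?thesis by simp
qed

lemma prob_sites:
  assumes p: "inj p"
  shows "(\<lambda>m. prob {\<omega> \<in> space M. expectation (\<lambda>\<omega>. c - \<bar>F \<omega> 0\<bar>) / 2 * real m \<le> (\<Sum>x=1..m. c - \<bar>F \<omega> (p x)\<bar>)}) \<longlonglongrightarrow> 1"
proof -
  have "(\<lambda>m. prob {\<omega> \<in> space M. expectation (\<lambda>\<omega>. c - \<bar>F \<omega> 0\<bar>) / 2 * real m \<le> (\<Sum>j<m. c - \<bar>F \<omega> (p (Suc j))\<bar>)}) \<longlonglongrightarrow> 1"
  proof (rule prob_sum_ge_half_mean)
    have "indep_vars (\<lambda>_. borel) (\<lambda>j \<omega>. (\<lambda>u. c - \<bar>fst u\<bar>) (env_var (Inl (p (Suc j))) \<omega>, env_var (Inl (p (Suc j))) \<omega>)) UNIV"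
      by (rule indep_vars_pairs[OF indep_env]) (use p in \<open>auto simp: disjoint_family_on_def inj_def\<close>)
    then show "indep_vars (\<lambda>_. borel) (\<lambda>j \<omega>. c - \<bar>F \<omega> (p (Suc j))\<bar>) UNIV" by simp
    show "AE \<omega> in M. c - \<bar>F \<omega> (p (Suc j))\<bar> \<in> {0..c}" for j
      using AE_F_bounded[of "p (Suc j)"] by eventually_elim auto
  qed (use c_pos expectation_site expectation_site_pos in auto)
  then show ?thesis by (simp add: sum.atLeast1_atMost_eq)
qed

lemma prob_change:
  assumes "i \<noteq> j" shows "prob {\<omega> \<in> space M. B \<omega> i \<noteq> B \<omega> j} = 1 / 2"
proof -
  have "prob {\<omega> \<in> space M. B \<omega> i \<noteq> B \<omega> j} = 
    prob ({\<omega> \<in> space M. B \<omega> i = 1 \<and> B \<omega> j = -1} \<union> {\<omega> \<in> space M. B \<omega> i = -1 \<and> B \<omega> j = 1})"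
    using AE_B_values[of i] AE_B_values[of j] by (intro finite_measure_eq_AE) auto
  also have "\<dots> = prob {\<omega> \<in> space M. B \<omega> i = 1 \<and> B \<omega> j = -1} + prob {\<omega> \<in> space M. B \<omega> i = -1 \<and> B \<omega> j = 1}"
    by (intro finite_measure_Union) auto
  also have "\<dots> = 1 / 2"
    using prob_env_pair[of "Inr i" "Inr j" "{1}" "{-1}"] prob_env_pair[of "Inr i" "Inr j" "{-1}" "{1}"] assms
    by (simp add: B_plus B_minus)
  finally show ?thesis .
qed

lemma prob_changes:
  "(\<lambda>m. prob {\<omega> \<in> space M. real m / 4 \<le> (\<Sum>j<m. if B \<omega> (int (2*j+1)) \<noteq> B \<omega> (int (2*j+2)) then 1 else 0)}) \<longlonglongrightarrow> 1"
proof -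
  define Y :: "nat \<Rightarrow> 'w \<Rightarrow> real" where "Y j \<omega> = (if B \<omega> (int (2*j+1)) \<noteq> B \<omega> (int (2*j+2)) then 1 else 0)" for j \<omega>
  have "(\<lambda>m. prob {\<omega> \<in> space M. (1 / 2) / 2 * real m \<le> (\<Sum>j<m. Y j \<omega>)}) \<longlonglongrightarrow> 1"
  proof (rule prob_sum_ge_half_mean)
    have "indep_vars (\<lambda>_. borel) (\<lambda>j \<omega>. (\<lambda>u. if fst u \<noteq> snd u then 1 else (0::real))
        (env_var (Inr (int (2*j+1))) \<omega>, env_var (Inr (int (2*j+2))) \<omega>)) UNIV"
    proof (rule indep_vars_pairs[OF indep_env])
      show "disjoint_family_on (\<lambda>j. {Inr (int (2 * j + 1)), Inr (int (2 * j + 2))}) UNIV"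
        using disjoint_family_on_pairs[of Inr 1] by (simp add: add.commute)
    qed measurable
    then show "indep_vars (\<lambda>_. borel) Y UNIV" by (simp add: Y_def[abs_def])
    show "AE \<omega> in M. Y j \<omega> \<in> {0..1}" for j by (simp add: Y_def)
    show "expectation (Y j) = 1 / 2" for j
    proof -
      have "expectation (Y j) = expectation (indicator {\<omega> \<in> space M. B \<omega> (int (2*j+1)) \<noteq> B \<omega> (int (2*j+2))})"
        by (intro Bochner_Integration.integral_cong) (auto simp: Y_def)
      also have "\<dots> = prob {\<omega> \<in> space M. B \<omega> (int (2*j+1)) \<noteq> B \<omega> (int (2*j+2))}" 
        unfolding Bochner_Integration.integral_indicator by (intro arg_cong[where f = prob]) auto
      also have "\<dots> = 1 / 2" by (rule prob_change) simp
      finally show ?thesis .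
    qed
  qed auto
  then show ?thesis by (simp add: Y_def)
qed

section \<open>Where the small gaps are\<close>

lemma prob_small_gap_le:
  assumes d: "0 < d"
  shows "prob {\<omega> \<in> space M. \<exists>x\<in>{- int N..int N}. dgap c (F \<omega>) x \<le> d} \<le> (2 * real N + 1) * (2 * (tail (2 * d))\<^sup>2)"
proof -
  have [measurable]: "{\<omega> \<in> space M. dgap c (F \<omega>) x \<le> d} \<in> events" for x unfolding dgap_def by measurable
  have "{\<omega> \<in> space M. \<exists>x\<in>{- int N..int N}. dgap c (F \<omega>) x \<le> d} = (\<Union>x\<in>{- int N..int N}. {\<omega> \<in> space M. dgap c (F \<omega>) x \<le> d})"
    by auto
  also have "prob \<dots> \<le> (\<Sum>x\<in>{- int N..int N}. prob {\<omega> \<in> space M. dgap c (F \<omega>) x \<le> d})"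
    by (rule finite_measure_subadditive_finite) auto
  also have "\<dots> \<le> (\<Sum>x\<in>{- int N..int N}. 2 * (tail (2 * d))\<^sup>2)"
    by (intro sum_mono prob_gap_le d)
  also have "\<dots> = (2 * real N + 1) * (2 * (tail (2 * d))\<^sup>2)" by simp
  finally show ?thesis .
qed

lemma filterlim_fraction_scale:
  assumes "0 < a" shows "filterlim (\<lambda>n. nat \<lfloor>a * real (scale n)\<rfloor>) at_top sequentially"
proof -
  have "LIM n sequentially. a * real (scale n) :> at_top"
    by (intro filterlim_tendsto_pos_mult_at_top[OF tendsto_const assms]
        filterlim_compose[OF filterlim_real_sequentially scale_at_top])
  then show ?thesis
    by (intro filterlim_compose[OF filterlim_nat_sequentially] filterlim_compose[OF filterlim_floor_sequentially])
qed

text \<open>A single edge has so small a gap with probability of order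
  \<open>D\<^sup>2 / scale n\<close>, where \<open>D\<close> depends on \<open>C\<close> through the
  tail scaling. About \<open>2 * a * scale n\<close> edges are tried, so a small \<open>a\<close>
  makes the union bound small.\<close>

lemma small_gap_unlikely:
  assumes C: "0 < C"
  shows "\<exists>a. 0 < a \<and> a \<le> 1 \<and> eventually (\<lambda>n. prob {\<omega> \<in> space M. \<exists>x\<in>{- int (nat \<lfloor>a * real (scale n)\<rfloor>)..int (nat \<lfloor>a * real (scale n)\<rfloor>)}.
      dgap c (F \<omega>) x \<le> C * real (scale n) / real n} \<le> 1 / 4) sequentially"
proof -
  obtain D e0 where D: "0 < D" "0 < e0" and sc: "\<And>e. 0 < e \<Longrightarrow> e \<le> e0 \<Longrightarrow> tail (2 * C * e) \<le> D * tail e"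
    using tail_scaling[of "2 * C"] C by auto
  \<comment> \<open>The two terms of the union bound become at most 1/8 each: the main one by this
    choice, the one from the central site by \<open>scale n \<ge> 16 * D\<^sup>2\<close>.\<close>
  define a where "a = min 1 (1 / (32 * D\<^sup>2))"
  have a: "0 < a" "a \<le> 1" "a * D\<^sup>2 \<le> 1 / 32"
  proof -
    have "a * D\<^sup>2 \<le> 1 / (32 * D\<^sup>2) * D\<^sup>2" using D by (intro mult_right_mono) (auto simp: a_def)
    then show "a * D\<^sup>2 \<le> 1 / 32" using D by simp
  qed (use D in \<open>auto simp: a_def\<close>)
  have "eventually (\<lambda>n. real (scale n) \<ge> 16 * D\<^sup>2) sequentially"
    using filterlim_compose[OF filterlim_real_sequentially scale_at_top] by (simp only: filterlim_at_top)
  moreover have "eventually (\<lambda>n. real (scale n) / real n < e0) sequentially"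
    using scale_ratio by (rule order_tendstoD(2)) (rule D)
  ultimately have "eventually (\<lambda>n. prob {\<omega> \<in> space M. \<exists>x\<in>{- int (nat \<lfloor>a * real (scale n)\<rfloor>)..int (nat \<lfloor>a * real (scale n)\<rfloor>)}.
      dgap c (F \<omega>) x \<le> C * real (scale n) / real n} \<le> 1 / 4) sequentially"
    using eventually_ge_at_top[of 1]
  proof eventually_elim
    case (elim n)
    define L where "L = real (scale n)"
    define N where "N = nat \<lfloor>a * L\<rfloor>"
    define p where "p = (tail (L / real n))\<^sup>2"
    have L: "1 \<le> L" "L * p \<le> 1" using scale_props[OF elim(3)] by (auto simp: L_def p_def)
    have N: "real N \<le> a * L" using a L by (simp add: N_def)
    have n: "0 < real n" using elim(3) by simp
    have d: "0 < C * L / real n" using C L n by simp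
    have "tail (2 * (C * L / real n)) \<le> D * tail (L / real n)"
      using sc[of "L / real n"] elim(2) L n by (simp add: L_def mult.assoc)
    then have "(tail (2 * (C * L / real n)))\<^sup>2 \<le> (D * tail (L / real n))\<^sup>2"
      using tail_nonneg by (intro power_mono) auto
    then have t: "(tail (2 * (C * L / real n)))\<^sup>2 \<le> D\<^sup>2 * p" by (simp add: p_def power_mult_distrib)
    have p0: "0 \<le> p" by (simp add: p_def)
    have "prob {\<omega> \<in> space M. \<exists>x\<in>{- int N..int N}. dgap c (F \<omega>) x \<le> C * L / real n} \<le>
        (2 * real N + 1) * (2 * (tail (2 * (C * L / real n)))\<^sup>2)"
      by (rule prob_small_gap_le[OF d])
    also have "\<dots> \<le> (2 * (a * L) + 1) * (2 * (D\<^sup>2 * p))"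
      using N t by (intro mult_mono) auto
    also have "\<dots> = 4 * (a * D\<^sup>2) * (L * p) + 2 * D\<^sup>2 * p" by (simp add: algebra_simps)
    also have "\<dots> \<le> 1 / 8 + 1 / 8"
    proof (rule add_mono)
      have "a * D\<^sup>2 * (L * p) \<le> 1 / 32 * 1"
        using a(3) L p0 by (intro mult_mono) auto
      then show "4 * (a * D\<^sup>2) * (L * p) \<le> 1 / 8" by simp
      have "16 * D\<^sup>2 * p \<le> L * p" using elim(1) p0 by (intro mult_right_mono) (auto simp: L_def)
      then show "2 * D\<^sup>2 * p \<le> 1 / 8" using L by simp
    qed
    finally show ?case by (simp add: N_def L_def)
  qed
  then show ?thesis using a by blast
qed

text \<open>By \<open>scale_lower\<close> each of the \<open>6 * scale n\<close> edges is good with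
  probability at least \<open>1 / (2 * scale n)\<close>, so all fail with probability at most
  \<open>exp (- 3)\<close>.\<close>

lemma good_edge_likely:
  "eventually (\<lambda>n. 3 / 4 \<le> prob {\<omega> \<in> space M. \<exists>j<6 * scale n. F \<omega> (2 * int j) > c - 2 * real (scale n) / real n \<and>
      F \<omega> (2 * int j + 1) < 2 * real (scale n) / real n - c}) sequentially"
  using scale_lower
proof eventually_elim
  case (elim n)
  define e where "e = 2 * real (scale n) / real n"
  let ?G = "{\<omega> \<in> space M. \<exists>j<6 * scale n. F \<omega> (2 * int j) > c - e \<and> F \<omega> (2 * int j + 1) < e - c}"
  have "1 - prob ?G = prob (space M - ?G)" by (subst prob_compl) auto
  also have "space M - ?G = {\<omega> \<in> space M. \<forall>j<6 * scale n. \<not> (F \<omega> (2 * int j) > c - e \<and> F \<omega> (2 * int j + 1) < e - c)}"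
    by auto
  also have "prob \<dots> \<le> exp (- (real (6 * scale n) * (tail e)\<^sup>2))" by (rule prob_no_good_edge)
  also have "\<dots> \<le> exp (- 3)" using elim by (simp add: e_def)
  also have "\<dots> \<le> 1 / 4" using exp_ge_add_one_self[of 3] by (simp add: exp_minus field_simps)
  finally show ?case by (simp add: e_def)
qed

end

context random_env_shape
begin

section \<open>The contradiction at a single large time\<close>

text \<open>For each \<open>n\<close> separately the shift by \<open>T n\<close> preserves the law,
  so \<open>T\<close> may depend on \<open>n\<close> in any way.\<close>

lemma excess_above_likely:
  assumes "0 \<le> \<sigma>" "0 \<le> m" "0 < \<epsilon>" "\<And>\<alpha>. \<sigma> \<le> \<alpha> \<Longrightarrow> \<alpha> \<le> 1 \<Longrightarrow> m * \<alpha> \<le> G \<alpha>"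
    and k: "filterlim k at_top sequentially"
  shows "(\<lambda>n. prob {\<omega> \<in> space M. excess_above c (\<lambda>i. B \<omega> (i - T n)) (F \<omega>) \<sigma> m \<epsilon> (k n)}) \<longlonglongrightarrow> 1"
  using prob_env_pred_tendsto_1[OF measurable_excess_above excess_above_mono AE_excess_above[OF assms(1-4)] k]
  by (simp add: prob_shift(2)[OF measurable_excess_above])

lemma excess_below_likely:
  assumes "\<sigma> \<le> 1 / 4" "0 \<le> m" "0 < \<epsilon>" "\<And>\<alpha>. 0 \<le> \<alpha> \<Longrightarrow> \<alpha> \<le> \<sigma> \<Longrightarrow> G \<alpha> \<le> m * \<alpha>"
    and k: "filterlim k at_top sequentially"
  shows "(\<lambda>n. prob {\<omega> \<in> space M. excess_below c (\<lambda>i. B \<omega> (i - T n)) (F \<omega>) \<sigma> m \<epsilon> (k n)}) \<longlonglongrightarrow> 1"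
  using prob_env_pred_tendsto_1[OF measurable_excess_below excess_below_mono AE_excess_below[OF assms(1-4)] k]
  by (simp add: prob_shift(2)[OF measurable_excess_below])

text \<open>The constants are chosen without circularity: \<open>\<delta>\<close> from the supposed
  failure, \<open>C\<close> and \<open>a\<close> from localization alone, then \<open>\<eta>\<close>
  from these three, \<open>\<sigma>\<close> from \<open>\<eta>\<close>, \<open>\<theta>\<close> from
  \<open>\<sigma>\<close>, and \<open>\<epsilon>\<close> from \<open>\<theta>\<close>.\<close>

lemma shape_linear:
  assumes K: "K > 1"
    and hyp: "(\<lambda>n. prob {\<omega> \<in> space M. \<exists>\<gamma> l.
                  free_minimizer (B \<omega>) (F \<omega>) n \<gamma> \<and> is_ell c (F \<omega>) n \<gamma> l \<and>
                  real (tau \<gamma> l) < K * real_of_int \<bar>l\<bar>}) \<longlonglongrightarrow> 1"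
    and v: "0 \<le> v" "v \<le> 1 / K"
  shows "G v = g * v"
proof (rule ccontr)
  assume neq: "G v \<noteq> g * v"
  have K1: "1 / K \<le> 1" using K by simp
  have v1: "v \<le> 1" using v(2) K1 by linarith
  have gt: "g * v < G v" using neq g_le[OF v(1) v1] by simp
  have v0: "0 < v" using gt v(1) G_0 by (cases "v = 0") auto
  define \<delta> where "\<delta> = G v / v - g"
  have \<delta>: "0 < \<delta>" using gt v0 by (simp add: \<delta>_def field_simps)
  have steep: "(g + \<delta>) * \<alpha> \<le> G \<alpha>" if "1 / K \<le> \<alpha>" "\<alpha> \<le> 1" for \<alpha>
  proof -
    have "v \<le> \<alpha>" "0 < \<alpha>" using v v0 that by auto
    then have "G v / v \<le> G \<alpha> / \<alpha>" using v0 that by (intro G_slope_mono) auto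
    then show ?thesis using \<open>0 < \<alpha>\<close> by (simp add: \<delta>_def field_simps)
  qed

  define \<mu> where "\<mu> = expectation (\<lambda>\<omega>. c - \<bar>F \<omega> 0\<bar>) / 2"
  have \<mu>: "0 < \<mu>" using expectation_site_pos by (simp add: \<mu>_def)
  \<comment> \<open>At distance \<open>C * L\<close> the new sites alone cost more than the
    competitor of \<open>minimizer_range_and_gap\<close>.\<close>
  obtain C :: nat where C: "(24 * c + 2) / \<mu> < real C" using reals_Archimedean2 by blast
  have C\<mu>: "24 * c + 2 < \<mu> * real C" using C \<mu> by (simp add: field_simps)
  have C0: "0 < real C"
  proof -
    have "0 < \<mu> * real C" using C\<mu> c_pos by linarith
    then show ?thesis using \<mu> by (simp add: zero_less_mult_iff)
  qed
  define C2 where "C2 = 12 * (24 * c + 2)"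
  have C2: "0 < C2" using c_pos by (simp add: C2_def)
  obtain a where a: "0 < a" "a \<le> 1" and gap: "eventually (\<lambda>n. prob {\<omega> \<in> space M. \<exists>x\<in>{- int (nat \<lfloor>a * real (scale n)\<rfloor>)..int (nat \<lfloor>a * real (scale n)\<rfloor>)}.
      dgap c (F \<omega>) x \<le> C2 * real (scale n) / real n} \<le> 1 / 4) sequentially"
    using small_gap_unlikely[OF C2] by blast
  \<comment> \<open>Chosen so that \<open>2 * \<eta> * C * L\<close> is a quarter of the gain
    \<open>\<delta> * a * L\<close>.\<close>
  define \<eta> where "\<eta> = \<delta> * a / (8 * real C)"
  have \<eta>: "0 < \<eta>" using \<delta> a C0 by (simp add: \<eta>_def)
  obtain \<sigma> where \<sigma>: "0 < \<sigma>" "\<sigma> \<le> 1 / 4" and flat: "\<And>\<alpha>. 0 \<le> \<alpha> \<Longrightarrow> \<alpha> \<le> \<sigma> \<Longrightarrow> G \<alpha> \<le> (g + \<eta>) * \<alpha>"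
    using g_approx[OF \<eta>] by blast
  \<comment> \<open>At time \<open>T = \<theta> * L\<close> the first leg is over by
    \<open>\<theta> > K * C\<close>, distances up to \<open>C * L\<close> are slow by
    \<open>\<theta> > C / \<sigma>\<close>, and the threshold \<open>N\<close> is passed by
    \<open>\<theta> > 1\<close>.\<close>
  obtain \<theta> :: nat where \<theta>: "max (K * real C) (max (real C / \<sigma>) 1) < real \<theta>" using reals_Archimedean2 by blast
  \<comment> \<open>Chosen so that \<open>6 * \<epsilon> * T\<close> is an eighth of the gain
    \<open>\<delta> * a * L\<close>.\<close>
  define \<epsilon> where "\<epsilon> = \<delta> * a / (48 * real \<theta>)"
  have \<epsilon>: "0 < \<epsilon>" using \<delta> a \<theta> by (simp add: \<epsilon>_def)
  obtain m :: nat where "K / (K - 1) < real m" using reals_Archimedean2 by blast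
  then have m: "K \<le> (K - 1) * real m" using K by (simp add: field_simps)

  define L where "L = scale"
  define N where "N n = nat \<lfloor>a * real (L n)\<rfloor>" for n
  define T where "T n = \<theta> * L n" for n
  have N_top: "filterlim N at_top sequentially"
    unfolding N_def L_def using filterlim_fraction_scale[OF a(1)] by simp
  have CL_top: "filterlim (\<lambda>n. C * L n) at_top sequentially"
    unfolding L_def using C0 filterlim_at_top_mono[OF scale_at_top] by simp
  have half_top: "filterlim (\<lambda>n::nat. n div 2) at_top sequentially"
    unfolding filterlim_at_top
  proof
    fix Z :: nat
    show "eventually (\<lambda>n. Z \<le> n div 2) sequentially"
      using eventually_ge_at_top[of "2 * Z"] by eventually_elim linarith
  qed

  define E1 where "E1 n = {\<omega> \<in> space M. \<exists>j<6 * L n. F \<omega> (2 * int j) > c - 2 * real (L n) / real n \<and>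
      F \<omega> (2 * int j + 1) < 2 * real (L n) / real n - c}" for n
  define E2 where "E2 n = {\<omega> \<in> space M. \<exists>x\<in>{- int (N n)..int (N n)}. dgap c (F \<omega>) x \<le> C2 * real (L n) / real n}" for n
  define S where "S p n = {\<omega> \<in> space M. \<mu> * real n \<le> (\<Sum>x=1..n. c - \<bar>F \<omega> (p x)\<bar>)}" for p n
  define R where "R n = {\<omega> \<in> space M. real n / 4 \<le> (\<Sum>j<n. if B \<omega> (int (2*j+1)) \<noteq> B \<omega> (int (2*j+2)) then 1 else 0)}" for n
  define V1 where "V1 n = {\<omega> \<in> space M. excess_above c (\<lambda>i. B \<omega> (i - 0)) (F \<omega>) (1 / K) (g + \<delta>) \<epsilon> (N n)}" for n
  define V2 where "V2 n = {\<omega> \<in> space M. excess_below c (\<lambda>i. B \<omega> (i - 0)) (F \<omega>) \<sigma> (g + \<eta>) \<epsilon> (N n)}" for n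
  define V3 where "V3 n = {\<omega> \<in> space M. excess_above c (\<lambda>i. B \<omega> (i - int (T n))) (F \<omega>) 0 g \<epsilon> (N n)}" for n
  define V4 where "V4 n = {\<omega> \<in> space M. excess_below c (\<lambda>i. B \<omega> (i - int (T n))) (F \<omega>) \<sigma> (g + \<eta>) \<epsilon> (N n)}" for n
  define H where "H n = {\<omega> \<in> space M. \<exists>\<gamma> l.
                  free_minimizer (B \<omega>) (F \<omega>) n \<gamma> \<and> is_ell c (F \<omega>) n \<gamma> l \<and>
                  real (tau \<gamma> l) < K * real_of_int \<bar>l\<bar>}" for n
  have ev: "E1 n \<in> events" "E2 n \<in> events" "S p n \<in> events" "R n \<in> events" for n p
    unfolding E1_def E2_def S_def R_def dgap_def by measurable
  have evV: "V1 n \<in> events" "V2 n \<in> events" "V3 n \<in> events" "V4 n \<in> events" for n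
    unfolding V1_def V2_def V3_def V4_def
    by (intro prob_shift(1) measurable_excess_above measurable_excess_below)+
  have pV1: "(\<lambda>n. prob (V1 n)) \<longlonglongrightarrow> 1" unfolding V1_def
    using excess_above_likely[of "1 / K" "g + \<delta>" \<epsilon> N "\<lambda>_. 0"] K g_nonneg \<delta> \<epsilon> steep N_top by simp
  have pV2: "(\<lambda>n. prob (V2 n)) \<longlonglongrightarrow> 1" unfolding V2_def
    using excess_below_likely[of \<sigma> "g + \<eta>" \<epsilon> N "\<lambda>_. 0"] g_nonneg \<sigma> \<eta> \<epsilon> flat N_top by simp
  have pV3: "(\<lambda>n. prob (V3 n)) \<longlonglongrightarrow> 1" unfolding V3_def
    using excess_above_likely[of 0 g \<epsilon> N "\<lambda>n. int (T n)"] g_nonneg \<epsilon> g_le N_top by simp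
  have pV4: "(\<lambda>n. prob (V4 n)) \<longlonglongrightarrow> 1" unfolding V4_def
    using excess_below_likely[of \<sigma> "g + \<eta>" \<epsilon> N "\<lambda>n. int (T n)"] g_nonneg \<sigma> \<eta> \<epsilon> flat N_top by simp
  have "(\<lambda>n. prob (S p n)) \<longlonglongrightarrow> 1" if "inj p" for p
    unfolding S_def \<mu>_def using prob_sites[OF that] by simp
  from filterlim_compose[OF this CL_top] have pS: "(\<lambda>n. prob (S p (C * L n))) \<longlonglongrightarrow> 1" if "inj p" for p
    using that by simp
  have "(\<lambda>n. prob (R n)) \<longlonglongrightarrow> 1" unfolding R_def by (rule prob_changes)
  from filterlim_compose[OF this half_top] have pR: "(\<lambda>n. prob (R (n div 2))) \<longlonglongrightarrow> 1" .
  define W where "W n = S int (C * L n) \<inter> (S (\<lambda>x. - int x) (C * L n) \<inter> (R (n div 2) \<inter> (V1 n \<inter> (V2 n \<inter> (V3 n \<inter> V4 n)))))" for n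
  have evW: "W n \<in> events" for n unfolding W_def by (intro sets.Int ev evV)
  have "(\<lambda>n. prob (W n)) \<longlonglongrightarrow> 1"
    unfolding W_def
    by (intro prob_tendsto_1_Int sets.Int ev evV pS pR pV1 pV2 pV3 pV4) (auto simp: inj_def)
  then have 1: "eventually (\<lambda>n. 7 / 8 < prob (W n)) sequentially" by (rule order_tendstoD(1)) simp
  have "(\<lambda>n. prob (H n)) \<longlonglongrightarrow> 1" unfolding H_def by (rule hyp)
  then have 2: "eventually (\<lambda>n. 7 / 8 < prob (H n)) sequentially" by (rule order_tendstoD(1)) simp
  have 3: "eventually (\<lambda>n. 3 / 4 \<le> prob (E1 n)) sequentially" unfolding E1_def L_def by (rule good_edge_likely)
  have 4: "eventually (\<lambda>n. prob (E2 n) \<le> 1 / 4) sequentially" unfolding E2_def L_def N_def by (rule gap)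
  have 5: "eventually (\<lambda>n. real (L n) / real n < 1 / real \<theta>) sequentially"
    unfolding L_def using scale_ratio by (rule order_tendstoD(2)) (use \<theta> in simp)
  have 6: "eventually (\<lambda>n. real (L n) \<ge> 2 * (\<delta> + \<epsilon> * real m + 2 * c * real m + 1) / (\<delta> * a)) sequentially"
    unfolding L_def using filterlim_compose[OF filterlim_real_sequentially scale_at_top] by (simp only: filterlim_at_top)
  have "eventually (\<lambda>n. False) sequentially"
    using 1 2 3 4 5 6 eventually_ge_at_top[of 2]
  proof eventually_elim
    case (elim n)
    have n0: "0 < real n" using elim(7) by simp
    \<comment> \<open>The event in the hypothesis quantifies over walks and is not shown measurable
      directly; a nonmeasurable set would have measure 0, against
      \<open>7 / 8 < prob (H n)\<close>.\<close>
    have evH: "H n \<in> events" using elim(2) measure_notin_sets[of "H n" M] by fastforce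
    \<comment> \<open>\<open>H n \<inter> W n\<close> has probability above 3/4 and the other
      intersection at least 1/2, so \<open>Q\<close> has probability above 1/4.\<close>
    define Q where "Q = (H n \<inter> W n) \<inter> (E1 n \<inter> (space M - E2 n))"
    have evQ: "Q \<in> events" unfolding Q_def by (intro sets.Int sets.Diff sets.top evH evW ev)
    have "prob (H n) + prob (W n) - 1 \<le> prob (H n \<inter> W n)"
      by (rule prob_Int_ge[OF evH evW])
    moreover have "prob (E1 n) + prob (space M - E2 n) - 1 \<le> prob (E1 n \<inter> (space M - E2 n))"
      by (rule prob_Int_ge) (auto intro: ev)
    moreover have "prob (space M - E2 n) = 1 - prob (E2 n)" by (rule prob_compl[OF ev(2)])
    moreover have "prob (H n \<inter> W n) + prob (E1 n \<inter> (space M - E2 n)) - 1 \<le> prob Q"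
      unfolding Q_def by (intro prob_Int_ge sets.Int sets.Diff sets.top evH evW ev)
    ultimately have "0 < prob Q" using elim(1-4) by linarith
    then obtain \<omega> where \<omega>: "\<omega> \<in> Q" and env: "admissible_env c (B \<omega>) (F \<omega>)"
      using AE_positive_prob_exists[OF AE_admissible_env evQ] by blast
    from \<omega> obtain \<gamma> l where min: "free_minimizer (B \<omega>) (F \<omega>) n \<gamma>" and ell: "is_ell c (F \<omega>) n \<gamma> l"
      and fast: "real (tau \<gamma> l) < K * real_of_int \<bar>l\<bar>"
      unfolding Q_def H_def by blast
    from \<omega> obtain j where j: "j < 6 * L n" "F \<omega> (2 * int j) > c - 2 * real (L n) / real n"
      "F \<omega> (2 * int j + 1) < 2 * real (L n) / real n - c" unfolding Q_def E1_def by blast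
    have sp: "\<omega> \<in> space M" using \<omega> unfolding Q_def by blast
    have sites: "\<mu> * real (C * L n) \<le> (\<Sum>x=1..C * L n. c - \<bar>F \<omega> (int x)\<bar>)"
      "\<mu> * real (C * L n) \<le> (\<Sum>x=1..C * L n. c - \<bar>F \<omega> (- int x)\<bar>)"
      using \<omega> unfolding Q_def W_def S_def by blast+
    have ch: "real (n div 2) / 4 \<le> (\<Sum>j<n div 2. if B \<omega> (int (2*j+1)) \<noteq> B \<omega> (int (2*j+2)) then 1 else 0)"
      using \<omega> unfolding Q_def W_def R_def by blast
    have range: "\<bar>\<gamma> i\<bar> \<le> int (C * L n)" if "i \<le> n" for i
      by (rule minimizer_range_and_gap(1)[OF env elim(7) min ell j C\<mu> sites ch that])
    have "dgap c (F \<omega>) l \<le> C2 * real (L n) / real n"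
      unfolding C2_def by (rule minimizer_range_and_gap(2)[OF env elim(7) min ell j C\<mu> sites ch])
    then have "l \<notin> {- int (N n)..int (N n)}" using \<omega> sp unfolding Q_def E2_def by blast
    then have lN: "int (N n) + 1 \<le> \<bar>l\<bar>" by auto
    have La: "a * real (L n) - 1 < real (N n)" "real (N n) \<le> a * real (L n)"
      using a unfolding N_def by (simp_all, linarith?)
    have V: "excess_above c (B \<omega>) (F \<omega>) (1 / K) (g + \<delta>) \<epsilon> (N n)" "excess_below c (B \<omega>) (F \<omega>) \<sigma> (g + \<eta>) \<epsilon> (N n)"
      "excess_above c (\<lambda>i. B \<omega> (i - int (T n))) (F \<omega>) 0 g \<epsilon> (N n)"
      "excess_below c (\<lambda>i. B \<omega> (i - int (T n))) (F \<omega>) \<sigma> (g + \<eta>) \<epsilon> (N n)"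
      using \<omega> unfolding Q_def W_def V1_def V2_def V3_def V4_def by simp_all
    have RT: "K * (real C * real (L n)) \<le> real (T n)"
      using mult_right_mono[of "K * real C" "real \<theta>" "real (L n)"] \<theta> by (simp add: T_def)
    have "real C \<le> \<sigma> * real \<theta>" using \<theta> \<sigma> by (simp add: field_simps)
    then have RT2: "real C * real (L n) \<le> \<sigma> * real (T n)"
      using mult_right_mono[of "real C" "\<sigma> * real \<theta>" "real (L n)"] by (simp add: T_def)
    have NT: "N n \<le> T n"
    proof -
      have "a * real (L n) \<le> 1 * real (L n)" using a by (intro mult_right_mono) auto
      moreover have "1 * real (L n) \<le> real \<theta> * real (L n)" using \<theta> by (intro mult_right_mono) auto
      ultimately have "real (N n) \<le> real (T n)" using La(2) by (simp add: T_def)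
      then show ?thesis by simp
    qed
    have Tn: "T n \<le> n"
    proof -
      have "real \<theta> * real (L n) < real n" using elim(5) n0 \<theta> by (simp add: field_simps)
      then have "real (T n) < real n" by (simp add: T_def)
      then show ?thesis by simp
    qed
    have key: "\<delta> * (real_of_int \<bar>l\<bar> - 1) \<le> 2 * \<eta> * (real C * real (L n)) + \<epsilon> * (6 * real (T n) + real m) + 2 * c * real m"
    proof (rule minimizer_first_leg_bound[OF env K g_nonneg _ _ _ min ell fast Tn RT RT2 _ NT _ _ m V])
      show "real_of_int \<bar>\<gamma> i\<bar> \<le> real C * real (L n)" if "i \<le> n" for i
      proof -
        have "real_of_int \<bar>\<gamma> i\<bar> \<le> real_of_int (int (C * L n))" using range[OF that] by (simp only: of_int_le_iff)
        then show ?thesis by simp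
      qed
      show "real (N n) \<le> real_of_int \<bar>l\<bar> - 1" using lN by linarith
    qed (use \<delta> \<eta> \<epsilon> \<sigma> in auto)
    have e1: "2 * \<eta> * (real C * real (L n)) = \<delta> * a * real (L n) / 4" using C0 by (simp add: \<eta>_def)
    have e2: "\<epsilon> * (6 * real (T n)) = \<delta> * a * real (L n) / 8" using \<theta> by (simp add: \<epsilon>_def T_def)
    have "\<delta> * (a * real (L n) - 1) \<le> \<delta> * (real_of_int \<bar>l\<bar> - 1)"
      using \<delta> La(1) lN by (intro mult_left_mono) linarith+
    moreover have "\<delta> * (a * real (L n) - 1) = \<delta> * a * real (L n) - \<delta>" by (simp add: algebra_simps)
    moreover have "\<epsilon> * (6 * real (T n) + real m) = \<epsilon> * (6 * real (T n)) + \<epsilon> * real m" by (rule distrib_left)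
    ultimately have "\<delta> * a * real (L n) - \<delta> \<le> \<delta> * a * real (L n) / 4 + \<delta> * a * real (L n) / 8 + \<epsilon> * real m + 2 * c * real m"
      using key e1 e2 by linarith
    \<comment> \<open>After the two errors, five eighths of \<open>\<delta> * a * L\<close> are
      bounded by fixed terms, whereas half of it already exceeds them.\<close>
    moreover have "2 * (\<delta> + \<epsilon> * real m + 2 * c * real m + 1) \<le> \<delta> * a * real (L n)"
      using elim(6) \<delta> a by (simp add: field_simps)
    moreover have "0 \<le> \<delta> + \<epsilon> * real m + 2 * c * real m" using \<delta> \<epsilon> c_pos by simp
    ultimately show False by argo
  qed
  then show False by simp
qed

end

theorem theorem2p7:
  fixes M :: "'w measure"
    and F :: "'w \<Rightarrow> int \<Rightarrow> real"
    and B :: "'w \<Rightarrow> int \<Rightarrow> real"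
    and \<rho> :: "real \<Rightarrow> real"
    and c q \<kappa> :: real
    and \<Lambda> :: "real \<Rightarrow> real"
    and K :: real
  assumes prob: "prob_space M"
    and c_pos: "c > 0" and q_pos: "q > 0" and kappa: "\<kappa> > -1"
    and indep: "prob_space.indep_vars M (\<lambda>_. borel)
                  (\<lambda>j \<omega>. case j of Inl x \<Rightarrow> F \<omega> x | Inr i \<Rightarrow> B \<omega> i) (UNIV :: (int + int) set)"
    and F_dens: "\<And>x. distributed M lborel (\<lambda>\<omega>. F \<omega> x) (\<lambda>y. ennreal (\<rho> y))"
    and B_plus: "\<And>i. measure M {\<omega> \<in> space M. B \<omega> i = 1} = 1/2"
    and B_minus: "\<And>i. measure M {\<omega> \<in> space M. B \<omega> i = -1} = 1/2"
    and rho_even: "\<And>y. \<rho> (- y) = \<rho> y"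
    and rho_cont: "continuous_on {-c<..<c} \<rho>"
    and rho_pos: "\<And>y. -c < y \<Longrightarrow> y < c \<Longrightarrow> \<rho> y > 0"
    and rho_zero: "\<And>y. \<bar>y\<bar> \<ge> c \<Longrightarrow> \<rho> y = 0"
    and rho_edge: "((\<lambda>y. \<rho> y / \<bar>c - y\<bar> powr \<kappa>) \<longlongrightarrow> q) (at_left c)"
    and shape: "\<And>\<alpha>. -1 \<le> \<alpha> \<Longrightarrow> \<alpha> \<le> 1 \<Longrightarrow>
                  AE \<omega> in M. (\<lambda>n. min_action (B \<omega>) (F \<omega>) n (round0 (\<alpha> * real n)) / real n)
                                 \<longlonglongrightarrow> - \<Lambda> \<alpha>"
    and K_gt: "K > 1"
    and hyp: "(\<lambda>n. measure M {\<omega> \<in> space M. \<exists>\<gamma> l.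
                  free_minimizer (B \<omega>) (F \<omega>) n \<gamma> \<and> is_ell c (F \<omega>) n \<gamma> l \<and>
                  real (tau \<gamma> l) < K * real_of_int \<bar>l\<bar>}) \<longlonglongrightarrow> 1"
  shows "\<exists>a b. \<forall>\<alpha>\<in>{0..1/K}. \<Lambda> \<alpha> = a * \<alpha> + b"
proof -
  interpret prob_space M by (rule prob)
  interpret random_env_shape M F B \<rho> c q \<kappa> \<Lambda>
    by unfold_locales (fact c_pos q_pos indep F_dens B_plus B_minus rho_even rho_pos rho_zero rho_edge shape)+
  have "\<Lambda> \<alpha> = (- g) * \<alpha> + c" if "\<alpha> \<in> {0..1/K}" for \<alpha>
    using shape_linear[OF K_gt hyp, of \<alpha>] that by (simp add: G_def)
  then show ?thesis by blast
qed

end
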